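(* Let $d=2r-1\geq 5$ be an odd integer and let $C_d\subset\mathbb{P}^2$ be the complex plane curve $$C_d: f_d=(y^3-x^2z)x^{r-3}y^{r-1}+x^d+y^d=0.$$ Then $C_d$ is a maximal Tjurina curve of type $(d,r)$ for any odd degree $d\geq 5$. Moreover, every curve $C_d$ is rational, has a unique singular point, namely $p=(0:0:1)$, and the plane curve singularity $(C_d,p)$ has exactly two branches.
   Context: Let $S=\mathbb{C}[x,y,z]$ with its standard grading, and let $C:f=0$ be a reduced curve of degree $d$ in the complex projective plane $\mathbb{P}^2$, with $f\in S$ homogeneous of degree $d$ and partial derivatives $f_x,f_y,f_z$. Let $$AR(f)=\{(a,b,c)\in S^3 : af_x+bf_y+cf_z=0\},$$ graded so that $(a,b,c)$ with $a,b,c$ homogeneous of degree $k$ has degree $k$, and let $mdr(f)$ be the minimal degree of a non-zero homogeneous element of $AR(f)$. The global Tjurina number $\tau(C)$ is the degree of the Jacobian ideal $J_f=(f_x,f_y,f_z)$ (i.e. $\dim_{\mathbb{C}}(S/J_f)_k$ for large $k$), equivalently the sum of the Tjurina numbers of all singular points of $C$. For integers $d,r$ with $d/2\leq r\leq d-1$ set $$\tau(d,r)_{max}=(d-1)(d-r-1)+r^2-\binom{2r-d+2}{2}.$$ A reduced plane curve $C:f=0$ is called a maximal Tjurina curve of type $(d,r)$ if $\deg f=d$, $mdr(f)=r$ and $\tau(C)=\tau(d,r)_{max}$. *)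

theory Defs
  imports "HOL-Computational_Algebra.Computational_Algebra"
begin

section \<open>The graded ring S = C[x,y,z]\<close>

text \<open>The ring is \<open>C[x][y][z]\<close>: the outermost variable is z, the innermost one is x, and the
  coefficient of \<open>x^i y^j z^l\<close> in \<open>f\<close> is \<open>coeff (coeff (coeff f l) j) i\<close>. Likewise
  \<open>C[s,t]\<close> is \<open>C[s][t]\<close>.\<close>

type_synonym poly2 = "complex poly poly"
type_synonym poly3 = "complex poly poly poly"

definition X :: poly3 where "X = [:[:[:0, 1:]:]:]"
definition Y :: poly3 where "Y = [:[:0, 1:]:]"
definition Z :: poly3 where "Z = [:0, 1:]"

definition const3 :: "complex \<Rightarrow> poly3" where "const3 c = [:[:[:c:]:]:]"

definition s2 :: poly2 where "s2 = [:[:0, 1:]:]"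
definition t2 :: poly2 where "t2 = [:0, 1:]"

definition const2 :: "complex \<Rightarrow> poly2" where "const2 c = [:[:c:]:]"

definition homogeneous2 :: "nat \<Rightarrow> poly2 \<Rightarrow> bool" where
  "homogeneous2 k g \<longleftrightarrow> (\<forall>i j. coeff (coeff g j) i \<noteq> 0 \<longrightarrow> i + j = k)"

definition homogeneous3 :: "nat \<Rightarrow> poly3 \<Rightarrow> bool" where
  "homogeneous3 k f \<longleftrightarrow> (\<forall>i j l. coeff (coeff (coeff f l) j) i \<noteq> 0 \<longrightarrow> i + j + l = k)"

text \<open>Evaluation at elements of a commutative \<open>C\<close>-algebra with structure map \<open>\<iota>\<close>.\<close>

definition eval2 :: "(complex \<Rightarrow> 'a::comm_ring_1) \<Rightarrow> poly2 \<Rightarrow> 'a \<Rightarrow> 'a \<Rightarrow> 'a" where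
  "eval2 \<iota> g a b = poly (map_poly (\<lambda>p. poly (map_poly \<iota> p) a) g) b"

definition eval3 :: "(complex \<Rightarrow> 'a::comm_ring_1) \<Rightarrow> poly3 \<Rightarrow> 'a \<Rightarrow> 'a \<Rightarrow> 'a \<Rightarrow> 'a" where
  "eval3 \<iota> f a b c = poly (map_poly (\<lambda>q. poly (map_poly (\<lambda>p. poly (map_poly \<iota> p) a) q) b) f) c"

definition dx :: "poly3 \<Rightarrow> poly3" where "dx f = map_poly (map_poly pderiv) f"
definition dy :: "poly3 \<Rightarrow> poly3" where "dy f = map_poly pderiv f"
definition dz :: "poly3 \<Rightarrow> poly3" where "dz f = pderiv f"


section \<open>Reduced curves, Jacobian syzygies and the global Tjurina number\<close>

definition reduced_curve :: "nat \<Rightarrow> poly3 \<Rightarrow> bool" where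
  "reduced_curve d f \<longleftrightarrow> d \<ge> 1 \<and> f \<noteq> 0 \<and> homogeneous3 d f \<and> squarefree f"

definition AR :: "poly3 \<Rightarrow> (poly3 \<times> poly3 \<times> poly3) set" where
  "AR f = {(a, b, c). a * dx f + b * dy f + c * dz f = 0}"

definition mdr :: "poly3 \<Rightarrow> nat" where
  "mdr f = (LEAST k. \<exists>a b c. (a, b, c) \<in> AR f \<and> (a, b, c) \<noteq> (0, 0, 0) \<and>
                       homogeneous3 k a \<and> homogeneous3 k b \<and> homogeneous3 k c)"

definition scale3 :: "complex \<Rightarrow> poly3 \<Rightarrow> poly3" where "scale3 c f = const3 c * f"

interpretation S: vector_space scale3
proof
  have add: "const3 (a + b) = const3 a + const3 b" and mult: "const3 (a * b) = const3 a * const3 b"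
    and one: "const3 1 = 1" for a b
    by (simp_all add: const3_def one_pCons)
  show "scale3 a (f + g) = scale3 a f + scale3 a g"
    and "scale3 (a + b) f = scale3 a f + scale3 b f"
    and "scale3 a (scale3 b f) = scale3 (a * b) f"
    and "scale3 1 f = f" for a b f g
    by (simp_all only: scale3_def add mult one distrib_left distrib_right mult.assoc mult_1_left)
qed

definition S_deg :: "nat \<Rightarrow> poly3 set" where "S_deg k = {f. homogeneous3 k f}"

definition jacobian_ideal :: "poly3 \<Rightarrow> poly3 set" where
  "jacobian_ideal f = {a * dx f + b * dy f + c * dz f | a b c. True}"

text \<open>\<open>B\<close> maps injectively onto a basis of the image of \<open>V\<close> in the quotient space by \<open>W\<close>.\<close>

definition basis_mod :: "poly3 set \<Rightarrow> poly3 set \<Rightarrow> poly3 set \<Rightarrow> bool" where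
  "basis_mod B V W \<longleftrightarrow> B \<subseteq> V \<and> S.independent B \<and> S.span B \<inter> W = {0} \<and>
     (\<forall>v\<in>V. \<exists>u\<in>S.span B. v - u \<in> W)"

definition quotient_dim :: "poly3 set \<Rightarrow> poly3 set \<Rightarrow> nat" where
  "quotient_dim V W = (THE n. \<exists>B. finite B \<and> basis_mod B V W \<and> card B = n)"

text \<open>For homogeneous \<open>f\<close> the image of \<open>S_deg k\<close> in \<open>S/J_f\<close> is the degree-k part of \<open>S/J_f\<close>.\<close>

definition global_tjurina :: "poly3 \<Rightarrow> nat" where
  "global_tjurina f =
     (THE n. \<forall>\<^sub>F k in sequentially. quotient_dim (S_deg k) (jacobian_ideal f) = n)"

text \<open>Meant for \<open>d \<le> 2 * r\<close>, so that the truncated difference is the integer \<open>2r - d + 2\<close>.\<close>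

definition tau_max :: "nat \<Rightarrow> nat \<Rightarrow> int" where
  "tau_max d r = (int d - 1) * (int d - int r - 1) + (int r)\<^sup>2 - int ((2 * r + 2 - d) choose 2)"

definition maximal_tjurina_curve :: "nat \<Rightarrow> nat \<Rightarrow> poly3 \<Rightarrow> bool" where
  "maximal_tjurina_curve d r f \<longleftrightarrow>
     d \<le> 2 * r \<and> r + 1 \<le> d \<and> reduced_curve d f \<and> mdr f = r \<and>
     int (global_tjurina f) = tau_max d r"


section \<open>Points of the projective plane, singular points\<close>

text \<open>A point of the projective plane is the set of all its homogeneous coordinate vectors.\<close>

definition proj_point :: "complex \<Rightarrow> complex \<Rightarrow> complex \<Rightarrow> (complex \<times> complex \<times> complex) set" where
  "proj_point a b c = {(k * a, k * b, k * c) | k. k \<noteq> 0}"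

definition singular_points :: "poly3 \<Rightarrow> (complex \<times> complex \<times> complex) set set" where
  "singular_points f = {proj_point a b c | a b c. (a, b, c) \<noteq> (0, 0, 0) \<and> eval3 id f a b c = 0 \<and>
     eval3 id (dx f) a b c = 0 \<and> eval3 id (dy f) a b c = 0 \<and> eval3 id (dz f) a b c = 0}"


section \<open>Rational curves\<close>

text \<open>A curve is rational if it is irreducible and birational to the projective line:
  \<open>(g0 : g1 : g2)\<close> is a rational map from the line to the curve, \<open>(h0 : h1)\<close> is a rational map
  from the curve to the line, and both compositions are defined and equal to the identity as
  rational maps. A form restricts to zero on the curve iff it is divisible by \<open>f\<close> (\<open>f\<close> being irreducible).\<close>

definition rational_curve :: "poly3 \<Rightarrow> bool" where
  "rational_curve f \<longleftrightarrow> irreducible f \<and>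
     (\<exists>m g0 g1 g2 e h0 h1.
        homogeneous2 m g0 \<and> homogeneous2 m g1 \<and> homogeneous2 m g2 \<and>
        (g0, g1, g2) \<noteq> (0, 0, 0) \<and> eval3 const2 f g0 g1 g2 = 0 \<and>
        homogeneous3 e h0 \<and> homogeneous3 e h1 \<and> \<not> (f dvd h0 \<and> f dvd h1) \<and>
        (let u = eval3 const2 h0 g0 g1 g2; v = eval3 const2 h1 g0 g1 g2
         in (u, v) \<noteq> (0, 0) \<and> u * t2 = v * s2) \<and>
        (let G0 = eval2 const3 g0 h0 h1; G1 = eval2 const3 g1 h0 h1; G2 = eval2 const3 g2 h0 h1
         in \<not> (f dvd G0 \<and> f dvd G1 \<and> f dvd G2) \<and>
            f dvd G0 * Y - G1 * X \<and> f dvd G0 * Z - G2 * X \<and> f dvd G1 * Z - G2 * Y))"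


section \<open>Branches\<close>

text \<open>The local ring of formal power series in two variables \<open>u\<close>, \<open>v\<close> is \<open>C[[u]][[v]]\<close>.\<close>

type_synonym fps2 = "complex fps fps"

definition u_loc :: fps2 where "u_loc = fps_const fps_X"
definition v_loc :: fps2 where "v_loc = fps_X"

definition const_loc :: "complex \<Rightarrow> fps2" where "const_loc c = fps_const (fps_const c)"

text \<open>Local equation at \<open>(a : b : c)\<close>, in the affine chart of the last nonzero coordinate and
  with the point translated to the origin.\<close>

definition local_eq :: "poly3 \<Rightarrow> complex \<Rightarrow> complex \<Rightarrow> complex \<Rightarrow> fps2" where
  "local_eq f a b c =
     (if c \<noteq> 0 then eval3 const_loc f (const_loc (a / c) + u_loc) (const_loc (b / c) + v_loc) 1
      else if b \<noteq> 0 then eval3 const_loc f (const_loc (a / b) + u_loc) 1 v_loc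
      else eval3 const_loc f 1 u_loc v_loc)"

text \<open>The branches at a point of a reduced curve are the irreducible factors of the local equation,
  up to associates.\<close>

definition branches :: "poly3 \<Rightarrow> complex \<Rightarrow> complex \<Rightarrow> complex \<Rightarrow> fps2 set set" where
  "branches f a b c =
     {p. irreducible p \<and> p dvd local_eq f a b c} // {(p, q). p dvd q \<and> q dvd p}"

end

theory Submission
  imports Defs "HOL-Computational_Algebra.Field_as_Ring"
begin

text \<open>
  The curve is \<open>form r x y - x^(r-1) y^(r-1) z\<close>, linear in z. Hence it is irreducible, and solving for
  z parametrises it rationally by \<open>(x : y)\<close>.

  Modulo the monomial \<open>x^(r-1) y^(r-1)\<close>, which is the z-derivative up to sign, the products \<open>x f_x\<close> and
  \<open>y f_y\<close> do not involve z. The ideal of \<open>C[x,y]\<close> generated by these three forms has an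
  explicit monomial complement, so that every member of the Jacobian ideal can be analysed
  coefficientwise in z, starting from the top power: for \<open>i, j < r\<close> the top terms of \<open>y^j f_x\<close> and
  \<open>x^i f_y\<close> are z times the distinct monomials \<open>x^(r-2) y^(r-1+j)\<close> and \<open>x^(r-1+i) y^(r-2)\<close> of that
  complement. This shows that there are no syzygies of degree below r, and that
  \<open>3 r^2 - 6 r + 1\<close> monomials form a basis of \<open>(S/J)_k\<close> for all large k.

  The rational parametrisation meets the singular point for \<open>x/y = 0\<close> and for \<open>y/x = 0\<close>. Each of the two
  parametrised germs has coprime orders in the two local coordinates, and the kernel of the
  corresponding map \<open>C[[u,v]] \<rightarrow> C[[s]]\<close> is generated by a prime element, by Weierstrass division.
  The order in v shows that the product of the two primes is the local equation up to a unit.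
\<close>

section \<open>Evaluation homomorphisms\<close>

text \<open>Both invariants come out of one count. The monomials x^i y^j with one exponent at most
  r-2 and the other at most 2r-2 are 3 r^2 - 4 r + 1 in number and independent modulo the z-free
  ideal. The derivatives f_x and f_y themselves, not multiplied by x or y respectively, contribute
  exactly 2 r further top terms: y^r f_x and x^r f_y give nothing new, because their coefficients in
  z already lie in that ideal. This is where the r in mdr = r comes from, and also tau = (3 r^2 - 4
  r + 1) - 2 r. The value r = 3 is exceptional throughout: the mixed term x^(r-3) y^(r+2) then
  coincides with y^5, and the rewriting rule that shifts exponents by r-3 stands still.\<close>

definition unital_hom :: "('a::comm_ring_1 \<Rightarrow> 'b::comm_ring_1) \<Rightarrow> bool" where
  "unital_hom h \<longleftrightarrow> h 1 = 1 \<and> (\<forall>a b. h (a + b) = h a + h b) \<and> (\<forall>a b. h (a * b) = h a * h b)"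

lemma unital_hom_simps:
  assumes "unital_hom h"
  shows "h 0 = 0" "h 1 = 1" "h (a + b) = h a + h b" "h (a * b) = h a * h b"
    "h (- a) = - h a" "h (a - b) = h a - h b" "h (a ^ n) = h a ^ n" "h (of_nat n) = of_nat n"
proof -
  show 1: "h 1 = 1" and add: "h (a + b) = h a + h b" and mult: "h (a * b) = h a * h b" for a b
    using assms by (auto simp: unital_hom_def)
  show 0: "h 0 = 0" using add[of 0 0] by simp
  have neg: "h (- a) = - h a" for a using add[of a "- a"] 0 by (simp add: add_eq_0_iff)
  then show "h (- a) = - h a" .
  show "h (a - b) = h a - h b" using add[of a "- b"] neg[of b] by simp
  show "h (a ^ n) = h a ^ n" by (induction n) (simp_all add: 1 mult)
  show "h (of_nat n) = of_nat n" by (induction n) (simp_all add: 0 1 add)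
qed

text \<open>Iterated two or three times it covers \<open>eval2\<close> and \<open>eval3\<close>,
  whose coefficient maps are themselves evaluations.\<close>

lemma unital_hom_poly:
  assumes "unital_hom h"
  shows "unital_hom (\<lambda>p. poly (map_poly h p) a)"
proof -
  note h = unital_hom_simps[OF assms]
  have add: "map_poly h (p + q) = map_poly h p + map_poly h q" for p q
    by (rule poly_eqI) (simp add: coeff_map_poly h)
  have smult: "map_poly h (smult c p) = smult (h c) (map_poly h p)" for c p
    by (rule poly_eqI) (simp add: coeff_map_poly h)
  have mult: "map_poly h (p * q) = map_poly h p * map_poly h q" for p q
    by (induction p) (simp_all add: add smult map_poly_pCons h)
  show ?thesis
    unfolding unital_hom_def by (simp add: add mult h)
qed

lemma unital_hom_eval2: "unital_hom h \<Longrightarrow> unital_hom (\<lambda>g. eval2 h g a b)"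
  unfolding eval2_def by (rule unital_hom_poly[OF unital_hom_poly])

lemma unital_hom_eval3: "unital_hom h \<Longrightarrow> unital_hom (\<lambda>g. eval3 h g a b c)"
  unfolding eval3_def by (rule unital_hom_poly[OF unital_hom_poly[OF unital_hom_poly]])

lemma eval2_vars:
  assumes "unital_hom h"
  shows "eval2 h s2 a b = a" "eval2 h t2 a b = b"
  using unital_hom_simps[OF assms] by (simp_all add: eval2_def s2_def t2_def map_poly_pCons)

lemma eval3_vars:
  assumes "unital_hom h"
  shows "eval3 h X a b c = a" "eval3 h Y a b c = b" "eval3 h Z a b c = c"
  using unital_hom_simps[OF assms]
  by (simp_all add: eval3_def X_def Y_def Z_def map_poly_pCons)

lemmas eval2_simps = unital_hom_simps[OF unital_hom_eval2] eval2_vars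
lemmas eval3_simps = unital_hom_simps[OF unital_hom_eval3] eval3_vars

lemma unital_hom_id: "unital_hom id" and unital_hom_const2: "unital_hom const2"
  and unital_hom_const3: "unital_hom const3"
  by (simp_all add: unital_hom_def const2_def const3_def one_pCons)

lemma unital_hom_const_loc: "unital_hom const_loc"
  by (simp add: unital_hom_def const_loc_def)


section \<open>The curve and its rational parametrisation\<close>

text \<open>On the curve z equals this form divided by x^(r-1) y^(r-1). It is polymorphic because it
  is evaluated at numbers, polynomials and power series.\<close>

definition form :: "nat \<Rightarrow> 'a::comm_ring_1 \<Rightarrow> 'a \<Rightarrow> 'a" where
  "form r x y = x ^ (2*r-1) + y ^ (2*r-1) + x ^ (r-3) * y ^ (r+2)"

lemma form_mult:
  assumes "r \<ge> 3"
  shows "form r (c * x) (c * y) = c ^ (2*r-1) * form r x y"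
proof -
  have "c ^ (2*r-1) = c ^ (r-3) * c ^ (r+2)"
    using assms by (simp only: power_add[symmetric]) (rule arg_cong[where f = "power c"], simp)
  then show ?thesis by (simp add: form_def power_mult_distrib algebra_simps)
qed

definition curve :: "nat \<Rightarrow> poly3" where
  "curve r = [:form r s2 t2, - (s2 ^ (r-1) * t2 ^ (r-1)):]"

lemma X_pow: "X ^ n = [:s2 ^ n:]" and Y_pow: "Y ^ n = [:t2 ^ n:]"
  by (induction n) (simp_all add: X_def Y_def s2_def t2_def one_pCons algebra_simps)

lemma curve_eq_XYZ:
  "curve r = form r X Y - X ^ (r-1) * Y ^ (r-1) * Z"
  by (simp add: curve_def form_def X_pow Y_pow Z_def del: power_Suc mult_pCons_left)

lemma curve_altdef:
  assumes "r \<ge> 3"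
  shows "(Y ^ 3 - X ^ 2 * Z) * X ^ (r - 3) * Y ^ (r - 1) + X ^ (2*r-1) + Y ^ (2*r-1) = curve r"
proof -
  obtain n where r: "r = n + 3" using assms by (metis add.commute le_Suc_ex)
  have "X ^ Suc (Suc n) = X ^ 2 * X ^ n" by (simp add: power2_eq_square)
  moreover have "Y ^ (n + 5) = Y ^ 3 * Y ^ Suc (Suc n)" by (simp only: power_add[symmetric]) (simp add: add.commute)
  ultimately show ?thesis
    by (simp add: curve_eq_XYZ form_def r algebra_simps del: power_Suc)
qed

section \<open>Partial derivatives\<close>

lemma dx_monom: "map_poly pderiv (s2 ^ i * t2 ^ j) = of_nat i * s2 ^ (i-1) * t2 ^ j"
  and dy_monom: "pderiv (s2 ^ i * t2 ^ j) = of_nat j * s2 ^ i * t2 ^ (j-1)"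
  and s2_pow: "s2 ^ i = [:monom 1 i:]" and t2_pow: "t2 ^ j = monom 1 j"
proof -
  show s: "s2 ^ i = [:monom 1 i:]" for i
    by (induction i) (simp_all add: s2_def monom_Suc one_pCons monom_0)
  show t: "t2 ^ j = monom 1 j" for j
    by (induction j) (simp_all add: t2_def monom_Suc monom_0 one_pCons smult_monom)
  have st: "s2 ^ i * t2 ^ j = monom (monom 1 i) j" for i j
    by (simp add: s t smult_monom)
  have nat: "of_nat n * monom (c :: complex poly) j = monom (of_nat n * c) j" for n c j
    by (simp add: of_nat_poly smult_monom)
  have nat1: "of_nat n * monom (c :: complex) j = monom (of_nat n * c) j" for n c j
    by (simp add: of_nat_poly smult_monom)
  show "map_poly pderiv (s2 ^ i * t2 ^ j) = of_nat i * s2 ^ (i-1) * t2 ^ j"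
    unfolding mult.assoc st by (simp add: map_poly_monom nat pderiv_monom nat1)
  show "pderiv (s2 ^ i * t2 ^ j) = of_nat j * s2 ^ i * t2 ^ (j-1)"
    unfolding mult.assoc st by (simp add: nat pderiv_monom)
qed

lemma map_pderiv_add: "map_poly pderiv (p + q) = map_poly pderiv p + map_poly pderiv q"
  by (rule poly_eqI) (simp add: coeff_map_poly pderiv_add)

lemma map_pderiv_minus: "map_poly pderiv (- p) = - map_poly pderiv p"
  for p :: "'a::idom poly poly"
  by (rule poly_eqI) (simp add: coeff_map_poly pderiv_minus)

text \<open>The truncated exponent \<open>r - 4\<close> is wrong for \<open>r = 3\<close>, but then its coefficient is 0.\<close>

definition Fx :: "nat \<Rightarrow> poly2" where
  "Fx r = of_nat (2*r-1) * s2 ^ (2*r-2) + of_nat (r-3) * s2 ^ (r-4) * t2 ^ (r+2)"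
definition Fy :: "nat \<Rightarrow> poly2" where
  "Fy r = of_nat (2*r-1) * t2 ^ (2*r-2) + of_nat (r+2) * s2 ^ (r-3) * t2 ^ (r+1)"
definition Px :: "nat \<Rightarrow> poly2" where "Px r = of_nat (r-1) * s2 ^ (r-2) * t2 ^ (r-1)"
definition Py :: "nat \<Rightarrow> poly2" where "Py r = of_nat (r-1) * s2 ^ (r-1) * t2 ^ (r-2)"
definition Mxy :: "nat \<Rightarrow> poly2" where "Mxy r = s2 ^ (r-1) * t2 ^ (r-1)"

lemma dx_curve: "dx (curve r) = [:Fx r, - Px r:]"
  and dy_curve: "dy (curve r) = [:Fy r, - Py r:]"
  and dz_curve: "dz (curve r) = [:- Mxy r:]"
proof -
  have s: "map_poly pderiv (s2 ^ i) = of_nat i * s2 ^ (i-1)"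
    "map_poly pderiv (t2 ^ i) = 0" for i
    using dx_monom[of i 0] dx_monom[of 0 i] by simp_all
  have t: "pderiv (t2 ^ j) = of_nat j * t2 ^ (j-1)" "pderiv (s2 ^ j) = 0" for j
    using dy_monom[of 0 j] dy_monom[of j 0] by simp_all
  have r: "2*r-1-1 = 2*r-2" "r-3-1 = r-4" "r-1-1 = r-2" "r+2-1=r+1" by simp_all
  show "dx (curve r) = [:Fx r, - Px r:]"
    unfolding dx_def curve_def form_def Fx_def Px_def
    by (simp only: map_poly_pCons map_pderiv_add map_pderiv_minus s dx_monom map_poly_0 r add_0_right map_poly_0)
  show "dy (curve r) = [:Fy r, - Py r:]"
    unfolding dy_def curve_def form_def Fy_def Py_def
    by (simp only: map_poly_pCons pderiv_add pderiv_minus pderiv_0 t dy_monom map_poly_0 r add_0_left)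
  show "dz (curve r) = [:- Mxy r:]"
    by (simp add: dz_def curve_def Mxy_def pderiv_pCons)
qed

section \<open>Irreducibility and reducedness\<close>

lemma form_zero_one: "form r (0::complex) 1 \<noteq> 0" "form r (1::complex) 0 \<noteq> 0" if "r \<ge> 3"
  using that by (auto simp: form_def power_0_left)

lemma prime_elem_s2: "prime_elem s2" and prime_elem_t2: "prime_elem t2"
proof -
  have "prime_elem ([:0, 1:] :: complex poly)" by (rule prime_elem_linear_poly) auto
  then show "prime_elem s2" by (simp add: s2_def prime_elem_const_poly_iff)
  show "prime_elem t2" unfolding t2_def by (rule prime_elem_linear_poly) auto
qed

text \<open>Only the primes s and t have to be excluded, and the values at (0:1) and (1:0) do so.
  The value at (0:1) is 1, or 2 for r = 3, when the mixed term is a power of t.\<close>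

lemma coprime_form:
  assumes "r \<ge> 3"
  shows "coprime (form r s2 t2) (s2 ^ (r-1) * t2 ^ (r-1))"
proof -
  note ev = eval2_simps[OF unital_hom_id]
  have evf: "eval2 id (form r s2 t2) a b = form r a b" for a b
    by (simp add: form_def ev)
  have "\<not> s2 dvd form r s2 t2"
  proof
    assume "s2 dvd form r s2 t2"
    then obtain k where "form r s2 t2 = s2 * k" by (elim dvdE)
    from this[THEN arg_cong, of "\<lambda>g. eval2 id g 0 1"] show False
      using form_zero_one[OF assms] by (simp add: evf ev)
  qed
  moreover have "\<not> t2 dvd form r s2 t2"
  proof
    assume "t2 dvd form r s2 t2"
    then obtain k where "form r s2 t2 = t2 * k" by (elim dvdE)
    from this[THEN arg_cong, of "\<lambda>g. eval2 id g 1 0"] show False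
      using form_zero_one[OF assms] by (simp add: evf ev)
  qed
  ultimately have "coprime s2 (form r s2 t2)" "coprime t2 (form r s2 t2)"
    by (auto intro!: prime_elem_imp_coprime prime_elem_s2 prime_elem_t2)
  then show ?thesis by (simp add: coprime_commute)
qed

lemma s2_nz[simp]: "s2 \<noteq> 0" and t2_nz[simp]: "t2 \<noteq> 0"
  by (simp_all add: s2_def t2_def)

lemma irreducible_curve: "r \<ge> 3 \<Longrightarrow> irreducible (curve r)"
  unfolding curve_def
  by (rule irreducible_linear_poly) (use coprime_form[of r] in auto)

lemma homogeneous2_add: "homogeneous2 k p \<Longrightarrow> homogeneous2 k q \<Longrightarrow> homogeneous2 k (p + q)"
  unfolding homogeneous2_def by (metis add.right_neutral coeff_add)

lemma homogeneous2_minus: "homogeneous2 k (- p) \<longleftrightarrow> homogeneous2 k p"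
  by (simp add: homogeneous2_def)

lemma homogeneous2_of_nat: "homogeneous2 k p \<Longrightarrow> homogeneous2 k (of_nat n * p)"
  by (simp add: homogeneous2_def of_nat_poly)

lemma homogeneous2_monom: "homogeneous2 (i + j) (s2 ^ i * t2 ^ j)"
  by (simp add: homogeneous2_def s2_pow t2_pow smult_monom)

lemma homogeneous2_monom': "i + j = k \<Longrightarrow> homogeneous2 k (s2 ^ i * t2 ^ j)"
  using homogeneous2_monom by blast

lemma homogeneous2_form:
  assumes "r \<ge> 3"
  shows "homogeneous2 (2*r-1) (form r s2 t2)"
proof -
  have "homogeneous2 (2*r-1) (s2 ^ (2*r-1))" "homogeneous2 (2*r-1) (t2 ^ (2*r-1))"
    using homogeneous2_monom[of "2*r-1" 0] homogeneous2_monom[of 0 "2*r-1"] by simp_all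
  moreover have "homogeneous2 (2*r-1) (s2 ^ (r-3) * t2 ^ (r+2))"
    by (rule homogeneous2_monom') (use assms in auto)
  ultimately show ?thesis by (simp add: form_def homogeneous2_add)
qed

lemma homogeneous3_iff: "homogeneous3 k f \<longleftrightarrow> (\<forall>l. coeff f l \<noteq> 0 \<longrightarrow> l \<le> k \<and> homogeneous2 (k - l) (coeff f l))"
proof -
  have "(\<exists>i j. coeff (coeff (coeff f l) j) i \<noteq> 0)" if "coeff f l \<noteq> 0" for l
    using that by (metis leading_coeff_0_iff)
  then show ?thesis unfolding homogeneous3_def homogeneous2_def
    by (metis (no_types, opaque_lifting) add_diff_cancel_right' coeff_0 le_add2 le_add_diff_inverse2)
qed

lemma homogeneous3_pCons: "homogeneous3 k [:p, q:]" if "homogeneous2 k p" "homogeneous2 (k - 1) q" "k \<ge> 1"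
  unfolding homogeneous3_iff using that by (auto simp: coeff_pCons split: nat.splits)

lemma reduced_curve_curve:
  assumes "r \<ge> 3"
  shows "reduced_curve (2*r-1) (curve r)"
proof -
  have irr: "irreducible (curve r)" by (rule irreducible_curve[OF assms])
  have "homogeneous2 (2*r-1-1) (s2 ^ (r-1) * t2 ^ (r-1))"
    by (rule homogeneous2_monom') (use assms in auto)
  then have "homogeneous3 (2*r-1) (curve r)"
    unfolding curve_def using assms homogeneous2_form[OF assms]
    by (intro homogeneous3_pCons) (auto simp: homogeneous2_minus)
  moreover have "squarefree (curve r)"
  proof (rule squarefreeI)
    fix x assume "x ^ 2 dvd curve r"
    then obtain k where k: "curve r = x * (x * k)" by (metis dvdE power2_eq_square mult.assoc)
    then show "is_unit x" using irreducibleD[OF irr k] by (auto intro: dvd_mult_left)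
  qed
  ultimately show ?thesis using assms irr by (auto simp: reduced_curve_def irreducible_def)
qed

section \<open>Rationality and the singular locus\<close>

lemma rational_curve_curve:
  assumes "r \<ge> 3"
  shows "rational_curve (curve r)"
proof -
  \<comment> \<open>The point (0:0:1) has multiplicity 2r-2 = d-1, so a line through it meets the
    curve in one further point. Hence the inverse map is the projection (X : Y), and the
    parametrisation is the equation solved for z and cleared of denominators.\<close>
  let ?f = "curve r" and ?g0 = "s2 ^ r * t2 ^ (r-1)" and ?g1 = "s2 ^ (r-1) * t2 ^ r" and ?g2 = "form r s2 t2"
  obtain n where r: "r = Suc n" using assms by (metis Suc_le_D numeral_3_eq_3)
  note e2 = eval3_simps[OF unital_hom_const2] and e3 = eval2_simps[OF unital_hom_const3]
  have g: "?g0 = (s2 ^ n * t2 ^ n) * s2" "?g1 = (s2 ^ n * t2 ^ n) * t2" by (simp_all add: r)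
  have curve0: "eval3 const2 ?f ?g0 ?g1 ?g2 = 0"
  proof -
    have "eval3 const2 ?f ?g0 ?g1 ?g2 = form r ?g0 ?g1 - ?g0 ^ n * ?g1 ^ n * ?g2"
      by (simp add: curve_eq_XYZ form_def e2 r)
    also have "form r ?g0 ?g1 = (s2 ^ n * t2 ^ n) ^ (2*r-1) * ?g2"
      unfolding g by (rule form_mult[OF assms])
    also have "(s2 ^ n * t2 ^ n) ^ (2*r-1) = ?g0 ^ n * ?g1 ^ n"
      unfolding g by (simp add: r power_mult_distrib mult_2 mult_2_right power_add mult_ac)
    finally show ?thesis by simp
  qed
  \<comment> \<open>The curve has z-degree 1, so it divides no nonzero z-free polynomial.\<close>
  have deg: "\<not> ?f dvd [:p:]" if "p \<noteq> 0" for p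
  proof
    assume "?f dvd [:p:]"
    then have "degree ?f \<le> degree [:p:]" using that by (intro dvd_imp_degree_le) auto
    then show False by (simp add: curve_def)
  qed
  have X: "X = [:s2:]" using X_pow[of 1] by simp
  have G: "eval2 const3 ?g0 X Y = X * (X ^ n * Y ^ n)" "eval2 const3 ?g1 X Y = Y * (X ^ n * Y ^ n)" "eval2 const3 ?g2 X Y = form r X Y"
    by (simp_all add: e3 form_def r)
  have f: "?f = form r X Y - X ^ n * Y ^ n * Z" by (simp add: curve_eq_XYZ r)
  have hom: "homogeneous2 (2*r-1) ?g0" "homogeneous2 (2*r-1) ?g1" "homogeneous2 (2*r-1) ?g2"
    by (intro homogeneous2_monom' homogeneous2_form; use assms in simp)+
  have homXY: "homogeneous3 1 X" "homogeneous3 1 Y"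
    by (auto simp: homogeneous3_def X_def Y_def coeff_pCons split: nat.splits)
  have nd: "\<not> ?f dvd X * (X ^ n * Y ^ n)"
    using deg[of "s2 * (s2 ^ n * t2 ^ n)"] by (simp add: X_pow Y_pow) (simp add: X mult_ac)
  \<comment> \<open>These minors are -X and -Y times the equation of the curve.\<close>
  have div: "?f dvd X * (X ^ n * Y ^ n) * Z - form r X Y * X" "?f dvd Y * (X ^ n * Y ^ n) * Z - form r X Y * Y"
    by (rule dvdI[of _ _ "- X"] dvdI[of _ _ "- Y"], simp add: f algebra_simps)+
  have dX: "\<not> ?f dvd X" using deg[of s2] by (simp add: X)
  have fin: "?g0 * t2 = ?g1 * s2" "X * (X ^ n * Y ^ n) * Y - Y * (X ^ n * Y ^ n) * X = 0"
    by (simp_all only: g) (simp_all add: mult_ac)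
  have u: "eval3 const2 X ?g0 ?g1 ?g2 = ?g0" "eval3 const2 Y ?g0 ?g1 ?g2 = ?g1" "?g0 \<noteq> 0"
    by (simp_all add: e2)
  show ?thesis
    unfolding rational_curve_def Let_def
    apply (rule conjI[OF irreducible_curve[OF assms]])
    apply (rule exI[of _ "2*r-1"], rule exI[of _ ?g0], rule exI[of _ ?g1], rule exI[of _ ?g2],
        rule exI[of _ 1], rule exI[of _ X], rule exI[of _ Y])
    unfolding G u fin
    apply (intro conjI)
    using hom homXY curve0 nd div dX u(3) by (fast | simp)+
qed

text \<open>f_z = 0 forces a b = 0. The equation of the curve then makes \<open>form r a b\<close>
  vanish, which is now a nonzero multiple of a pure power, so a = b = 0.\<close>

lemma singular_points_curve:
  assumes "r \<ge> 3"
  shows "singular_points (curve r) = {proj_point 0 0 1}"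
proof -
  note ev = eval3_simps[OF unital_hom_id]
  have C: "[:s2 ^ i * t2 ^ j:] = X ^ i * Y ^ j" for i j by (simp add: X_pow Y_pow)
  have of_nat_C: "[:of_nat n:] = (of_nat n :: poly3)" for n by (simp add: of_nat_poly)
  have pC: "[:p, q:] = [:p:] + [:q:] * Z" for p q :: poly2 by (simp add: Z_def)
  have pM: "[:p * q:] = [:p:] * [:q:]" "[:p + q:] = [:p:] + [:q:]" "[:-p:] = -[:p:]" for p q :: poly2 by simp_all
  have evp: "eval3 id [:s2 ^ i:] a b c = a ^ i" "eval3 id [:t2 ^ i:] a b c = b ^ i" for i a b c
    by (simp_all flip: X_pow Y_pow add: ev)
  have fx: "eval3 id (dx (curve r)) a b c = of_nat (2*r-1) * a ^ (2*r-2) + of_nat (r-3) * a ^ (r-4) * b ^ (r+2)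
      - of_nat (r-1) * a ^ (r-2) * b ^ (r-1) * c" for a b c
    unfolding dx_curve pC unfolding Fx_def Px_def pM of_nat_C by (simp only: ev evp) simp
  have fy: "eval3 id (dy (curve r)) a b c = of_nat (2*r-1) * b ^ (2*r-2) + of_nat (r+2) * a ^ (r-3) * b ^ (r+1)
      - of_nat (r-1) * a ^ (r-1) * b ^ (r-2) * c" for a b c
    unfolding dy_curve pC unfolding Fy_def Py_def pM of_nat_C by (simp only: ev evp) simp
  have fz: "eval3 id (dz (curve r)) a b c = - (a ^ (r-1) * b ^ (r-1))" for a b c
    unfolding dz_curve Mxy_def pM by (simp only: ev evp)
  have f: "eval3 id (curve r) a b c = form r a b - a ^ (r-1) * b ^ (r-1) * c" for a b c
    by (simp add: curve_eq_XYZ form_def ev)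
  have zero: "a = 0 \<and> b = 0" if "eval3 id (curve r) a b c = 0" "eval3 id (dz (curve r)) a b c = 0" for a b c
  proof -
    have "a = 0 \<or> b = 0" using that(2) unfolding fz by auto
    moreover have "form r a b = 0" using that f[of a b c] fz[of a b c] by simp
    ultimately show ?thesis using assms by (cases "r = 3") (auto simp: form_def power_0_left split: if_splits)
  qed
  have pt: "eval3 id (curve r) 0 0 1 = 0" "eval3 id (dx (curve r)) 0 0 1 = 0"
     "eval3 id (dy (curve r)) 0 0 1 = 0" "eval3 id (dz (curve r)) 0 0 1 = 0"
    using assms by (simp_all add: f fx fy fz form_def power_0_left)
  have pp: "proj_point 0 0 c = proj_point 0 0 1" if "c \<noteq> 0" for c
  proof -
    have "(0, 0, k * 1) \<in> proj_point 0 0 c" if "k \<noteq> 0" for k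
      unfolding proj_point_def using \<open>c \<noteq> 0\<close> that by (auto intro!: exI[of _ "k / c"])
    moreover have "(0, 0, k * c) \<in> proj_point 0 0 1" if "k \<noteq> 0" for k
      unfolding proj_point_def using \<open>c \<noteq> 0\<close> that by auto
    ultimately show ?thesis by (auto simp: proj_point_def)
  qed
  show ?thesis
  proof (intro equalityI subsetI)
    fix x assume "x \<in> singular_points (curve r)"
    then obtain a b c where x: "x = proj_point a b c" "(a, b, c) \<noteq> (0, 0, 0)"
      "eval3 id (curve r) a b c = 0" "eval3 id (dz (curve r)) a b c = 0"
      unfolding singular_points_def by blast
    with zero[OF x(3,4)] pp[of c] show "x \<in> {proj_point 0 0 1}" by simp
  next
    fix x assume "x \<in> {proj_point 0 0 1}"
    then show "x \<in> singular_points (curve r)"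
      unfolding singular_points_def mem_Collect_eq using pt
      by (intro exI[of _ "0::complex"] exI[of _ "1::complex"]) simp
  qed
qed

section \<open>The Jacobian ideal and its syzygies\<close>

definition cf :: "poly2 \<Rightarrow> nat \<Rightarrow> nat \<Rightarrow> complex" where "cf p i j = coeff (coeff p j) i"

lemma poly2_eqI: "(\<And>i j. cf p i j = cf q i j) \<Longrightarrow> p = q"
  unfolding cf_def by (intro poly_eqI) auto

lemma cf_0 [simp]: "cf 0 i j = 0"
  and cf_add [simp]: "cf (p + q) i j = cf p i j + cf q i j"
  and cf_minus [simp]: "cf (- p) i j = - cf p i j"
  and cf_diff [simp]: "cf (p - q) i j = cf p i j - cf q i j"
  and cf_of_nat [simp]: "cf (of_nat n * p) i j = of_nat n * cf p i j"
  and cf_const2 [simp]: "cf (const2 c * p) i j = c * cf p i j"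
  by (simp_all add: cf_def of_nat_poly const2_def)

lemma s2_t2_monom: "s2 ^ i * t2 ^ j = monom (monom 1 i) j"
  by (simp add: s2_pow t2_pow smult_monom)

lemma cf_monom_mult: "cf (s2 ^ a * t2 ^ b * p) i j = (if a \<le> i \<and> b \<le> j then cf p (i-a) (j-b) else 0)"
  unfolding s2_t2_monom by (simp add: cf_def coeff_monom_mult)

lemma cf_monom: "cf (s2 ^ a * t2 ^ b) i j = (if i = a \<and> j = b then 1 else 0)"
  unfolding s2_t2_monom by (auto simp add: cf_def)

text \<open>\<open>Fs r\<close> and \<open>Gs r\<close> are x \<open>Fx r\<close> and y
  \<open>Fy r\<close>, the z-free parts of x f_x and y f_y. After the multiplication the mixed
  exponent is r-3, which is correct for r = 3 as well.\<close>

definition Fs :: "nat \<Rightarrow> poly2" where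
  "Fs r = of_nat (2*r-1) * s2 ^ (2*r-1) + of_nat (r-3) * (s2 ^ (r-3) * t2 ^ (r+2))"
definition Gs :: "nat \<Rightarrow> poly2" where
  "Gs r = of_nat (2*r-1) * t2 ^ (2*r-1) + of_nat (r+2) * (s2 ^ (r-3) * t2 ^ (r+2))"

lemma power_Suc': "Suc a = b \<Longrightarrow> (x :: 'a :: monoid_mult) * x ^ a = x ^ b"
  by auto

lemma s2_Fx: assumes "r \<ge> 3" shows "s2 * Fx r = Fs r"
proof -
  have "s2 * Fx r = of_nat (2*r-1) * (s2 * s2 ^ (2*r-2)) + of_nat (r-3) * ((s2 * s2 ^ (r-4)) * t2 ^ (r+2))"
    by (simp only: Fx_def distrib_left mult_ac)
  moreover have "s2 * s2 ^ (2*r-2) = s2 ^ (2*r-1)" by (rule power_Suc') (use assms in simp)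
  moreover have "r = 3 \<or> s2 * s2 ^ (r-4) = s2 ^ (r-3)" using power_Suc'[of "r-4" "r-3" s2] assms by linarith
  ultimately show ?thesis by (auto simp: Fs_def)
qed

lemma t2_Fy: assumes "r \<ge> 3" shows "t2 * Fy r = Gs r"
proof -
  have "t2 * Fy r = of_nat (2*r-1) * (t2 * t2 ^ (2*r-2)) + of_nat (r+2) * (s2 ^ (r-3) * (t2 * t2 ^ (r+1)))"
    by (simp only: Fy_def distrib_left mult_ac)
  moreover have "t2 * t2 ^ (2*r-2) = t2 ^ (2*r-1)" "t2 * t2 ^ (r+1) = t2 ^ (r+2)"
    by (rule power_Suc'; use assms in simp)+
  ultimately show ?thesis by (simp only: Gs_def)
qed

lemma s2_Px: assumes "r \<ge> 3" shows "s2 * Px r = of_nat (r-1) * Mxy r"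
proof -
  have "s2 * Px r = of_nat (r-1) * ((s2 * s2 ^ (r-2)) * t2 ^ (r-1))" by (simp only: Px_def mult_ac)
  moreover have "s2 * s2 ^ (r-2) = s2 ^ (r-1)" by (rule power_Suc') (use assms in simp)
  ultimately show ?thesis by (simp only: Mxy_def)
qed

lemma t2_Py: assumes "r \<ge> 3" shows "t2 * Py r = of_nat (r-1) * Mxy r"
proof -
  have "t2 * Py r = of_nat (r-1) * (s2 ^ (r-1) * (t2 * t2 ^ (r-2)))" by (simp only: Py_def mult_ac)
  moreover have "t2 * t2 ^ (r-2) = t2 ^ (r-1)" by (rule power_Suc') (use assms in simp)
  ultimately show ?thesis by (simp only: Mxy_def)
qed

section \<open>The ideal in C[x,y] and its monomial complement\<close>

definition ideal_xy :: "nat \<Rightarrow> poly2 set" where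
  "ideal_xy r = {a * Fs r + b * Gs r + c * Mxy r | a b c. True}"

lemma ideal_xy_I: "a * Fs r + b * Gs r + c * Mxy r \<in> ideal_xy r" by (auto simp: ideal_xy_def)

lemma ideal_xy_gens: "Fs r \<in> ideal_xy r" "Gs r \<in> ideal_xy r" "Mxy r \<in> ideal_xy r"
  using ideal_xy_I[of 1 r 0 0] ideal_xy_I[of 0 r 1 0] ideal_xy_I[of 0 r 0 1] by simp_all

lemma ideal_xy_add: assumes "p \<in> ideal_xy r" "q \<in> ideal_xy r" shows "p + q \<in> ideal_xy r"
proof -
  obtain a b c a' b' c' where "p = a * Fs r + b * Gs r + c * Mxy r" "q = a' * Fs r + b' * Gs r + c' * Mxy r"
    using assms by (auto simp: ideal_xy_def)
  then have "p + q = (a+a') * Fs r + (b+b') * Gs r + (c+c') * Mxy r" by (simp add: algebra_simps)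
  then show ?thesis using ideal_xy_I by simp
qed

lemma ideal_xy_mult: assumes "p \<in> ideal_xy r" shows "q * p \<in> ideal_xy r"
proof -
  obtain a b c where "p = a * Fs r + b * Gs r + c * Mxy r"
    using assms by (auto simp: ideal_xy_def)
  then have "q * p = (q*a) * Fs r + (q*b) * Gs r + (q*c) * Mxy r" by (simp add: algebra_simps)
  then show ?thesis using ideal_xy_I by simp
qed

lemma ideal_xy_diff: "p \<in> ideal_xy r \<Longrightarrow> q \<in> ideal_xy r \<Longrightarrow> p - q \<in> ideal_xy r"
  using ideal_xy_add[of p r "-q"] ideal_xy_mult[of q r "-1"] by simp

lemma ideal_xy_of_nat_cancel: assumes "of_nat n * p \<in> ideal_xy r" "n > 0" shows "p \<in> ideal_xy r"
proof -
  have "const2 (1 / of_nat n) * (of_nat n * p) = p"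
    by (rule poly2_eqI) (use assms(2) in simp)
  then show ?thesis using ideal_xy_mult[OF assms(1)] by metis
qed

lemma coeff_xy_ideal_xy:
  "cf (a * Fs r + b * Gs r + c * Mxy r) i j =
     of_nat (2*r-1) * (if 2*r-1 \<le> i then cf a (i-(2*r-1)) j else 0)
   + of_nat (r-3) * (if r-3 \<le> i \<and> r+2 \<le> j then cf a (i-(r-3)) (j-(r+2)) else 0)
   + of_nat (2*r-1) * (if 2*r-1 \<le> j then cf b i (j-(2*r-1)) else 0)
   + of_nat (r+2) * (if r-3 \<le> i \<and> r+2 \<le> j then cf b (i-(r-3)) (j-(r+2)) else 0)
   + (if r-1 \<le> i \<and> r-1 \<le> j then cf c (i-(r-1)) (j-(r-1)) else 0)"
proof -
  have e: "a * Fs r + b * Gs r + c * Mxy r =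
     of_nat (2*r-1) * (s2 ^ (2*r-1) * t2 ^ 0 * a) + of_nat (r-3) * (s2 ^ (r-3) * t2 ^ (r+2) * a)
   + of_nat (2*r-1) * (s2 ^ 0 * t2 ^ (2*r-1) * b) + of_nat (r+2) * (s2 ^ (r-3) * t2 ^ (r+2) * b)
   + s2 ^ (r-1) * t2 ^ (r-1) * c" by (simp add: Fs_def Gs_def Mxy_def algebra_simps)
  show ?thesis unfolding e by (simp only: cf_add cf_of_nat cf_monom_mult) simp
qed

text \<open>Just outside the allowed region, h has no terms x^(2r-1+i) y^j or x^j y^(2r-1+i) with j
  at most r-2. Their coefficients show that the low rows of a vanish and that b obeys a recursion
  with step r-3. Inside the region only the mixed monomial could contribute, and it meets only
  entries of a and b already known to vanish. The last two conclusions are meant for relations (h =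
  0) with factors of low degree.\<close>

lemma ideal_xy_normal_exps:
  assumes r: "r \<ge> 3" and h: "h = a * Fs r + b * Gs r + c * Mxy r"
    and supp: "\<And>i j. cf h i j \<noteq> 0 \<Longrightarrow> (i \<le> r-2 \<and> j \<le> 2*r-2) \<or> (j \<le> r-2 \<and> i \<le> 2*r-2)"
  shows "h = 0" and "j \<le> r-2 \<Longrightarrow> cf a i j = 0" and "a = 0 \<Longrightarrow> i \<le> r-2 \<Longrightarrow> cf b i j = 0"
proof -
  note cfh = coeff_xy_ideal_xy[of a r b c, folded h]
  have nz: "of_nat (2*r-1) \<noteq> (0::complex)" "of_nat (r+2) \<noteq> (0::complex)" using r unfolding of_nat_eq_0_iff by simp_all
  have a: "cf a i j = 0" if "j \<le> r-2" for i j
  proof -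
    have "cf h (i + (2*r-1)) j = 0" using supp[of "i + (2*r-1)" j] r that by fastforce
    then show ?thesis using cfh[of "i + (2*r-1)" j] that nz r by (simp split: if_splits)
  qed
  then show "j \<le> r-2 \<Longrightarrow> cf a i j = 0" .
  \<comment> \<open>The coefficient of x^i y^(j+2r-1) with i at most r-2, which the multiples of
    x^(2r-1) and of \<open>Mxy r\<close> do not reach.\<close>
  have col: "0 = of_nat (r-3) * (if r-3 \<le> i then cf a (i-(r-3)) (j+(r-3)) else 0)
      + of_nat (2*r-1) * cf b i j + of_nat (r+2) * (if r-3 \<le> i then cf b (i-(r-3)) (j+(r-3)) else 0)"
    if "i \<le> r-2" for i j
  proof -
    have "cf h i (j + (2*r-1)) = 0" using supp[of i "j + (2*r-1)"] r that by fastforce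
    moreover have "j + (2*r-1) - (r+2) = j + (r-3)" "\<not> 2*r-1 \<le> i" "\<not> r-1 \<le> i" "r+2 \<le> j + (2*r-1)" "2*r-1 \<le> j + (2*r-1)"
      using r that by simp_all
    ultimately show ?thesis using cfh[of i "j + (2*r-1)"]
      by (simp only: add_diff_cancel_right' if_True if_False simp_thms mult_zero_right add_0_left add_0_right)
  qed
  show b: "a = 0 \<Longrightarrow> i \<le> r-2 \<Longrightarrow> cf b i j = 0"
  proof (induction i arbitrary: j rule: less_induct)
    case (less i)
    show ?case
    proof (cases "r = 3")
      \<comment> \<open>The step r-3 is 0, and the two terms in b merge into 10 times a single
        coefficient.\<close>
      case True
      then show ?thesis using col[of i j] less.prems by (auto simp flip: distrib_right)
    next
      case False
      then have "(if r-3 \<le> i then cf b (i-(r-3)) (j+(r-3)) else 0) = 0" using less r by auto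
      moreover have "(if r-3 \<le> i then cf a (i-(r-3)) (j+(r-3)) else 0) = 0" using less.prems by simp
      ultimately have "of_nat (2*r-1) * cf b i j = 0"
        using col[OF less.prems(2), of j] by (simp only: mult_zero_right add_0_left add_0_right)
      then show ?thesis using nz by (simp only: mult_eq_0_iff simp_thms)
    qed
  qed
  \<comment> \<open>These are the entries that the mixed monomial can carry into the region. For i <
    r-3 the recursion has no other term; the only leftover is r = 4 with i = 1, j = 0.\<close>
  have b0: "cf b i j = 0" if "i \<le> 1" "i < r-2" "j + 4 \<le> r" for i j
  proof -
    have *: "cf b i j = 0" if "i < r - 3" for i j
    proof -
      have "\<not> r-3 \<le> i" "i \<le> r-2" using that by simp_all
      then have "of_nat (2*r-1) * cf b i j = 0"
        using col[of i j] by (simp only: if_False mult_zero_right add_0_left add_0_right)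
      then show ?thesis using nz by (simp only: mult_eq_0_iff simp_thms)
    qed
    show ?thesis
    proof (cases "i < r-3")
      case False
      then have "r = 4" "i = 1" "j = 0" using that r by auto
      then show ?thesis using col[of 1 0] *[of 0] a[of 1 0] by simp
    qed (rule *)
  qed
  show "h = 0"
  proof (rule poly2_eqI, unfold cf_0, rule ccontr)
    fix i j assume nz: "cf h i j \<noteq> 0"
    from supp[OF this] show False
    proof
      assume "j \<le> r-2 \<and> i \<le> 2*r-2"
      then have "\<not> 2*r-1 \<le> i" "\<not> r+2 \<le> j" "\<not> 2*r-1 \<le> j" "\<not> r-1 \<le> j" using r by linarith+
      then show False using nz cfh[of i j] by (simp only: if_False simp_thms mult_zero_right add_0_left)
    next
      assume ij: "i \<le> r-2 \<and> j \<le> 2*r-2"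
      have "cf a (i-(r-3)) (j-(r+2)) = 0" by (rule a) (use ij r in linarith)
      moreover have "cf b (i-(r-3)) (j-(r+2)) = 0" if "r-3 \<le> i" "r+2 \<le> j"
        by (rule b0) (use ij r that in linarith)+
      ultimately have "(if r-3 \<le> i \<and> r+2 \<le> j then cf a (i-(r-3)) (j-(r+2)) else 0) = 0"
        "(if r-3 \<le> i \<and> r+2 \<le> j then cf b (i-(r-3)) (j-(r+2)) else 0) = 0" by auto
      moreover have "\<not> 2*r-1 \<le> i" "\<not> 2*r-1 \<le> j" "\<not> r-1 \<le> i" using r ij by linarith+
      ultimately show False using nz cfh[of i j] by (simp only: if_False simp_thms mult_zero_right add_0_left)
    qed
  qed
qed

section \<open>Rewriting monomials modulo the ideal\<close>

lemma monom_in_ideal_xy: "r - 1 \<le> i \<Longrightarrow> r - 1 \<le> j \<Longrightarrow> s2 ^ i * t2 ^ j \<in> ideal_xy r"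
proof -
  assume "r - 1 \<le> i" "r - 1 \<le> j"
  then have "s2 ^ i * t2 ^ j = (s2 ^ (i-(r-1)) * t2 ^ (j-(r-1))) * Mxy r"
    by (auto simp: Mxy_def power_add mult_ac dest!: le_Suc_ex)
  then show ?thesis using ideal_xy_mult[OF ideal_xy_gens(3)] by simp
qed

text \<open>A move by \<open>Gs r\<close> shifts a monomial of high y-degree by r-3 towards the
  diagonal, keeping the total degree. Once both exponents reach r-1 the monomial is a multiple of
  \<open>Mxy r\<close>.\<close>

lemma Gs_reduction:
  assumes "r \<ge> 3" "2*r-1 \<le> j"
  shows "of_nat (2*r-1) * (s2 ^ i * t2 ^ j) = s2 ^ i * t2 ^ (j-(2*r-1)) * Gs r - of_nat (r+2) * (s2 ^ (i+(r-3)) * t2 ^ (j-(r-3)))"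
proof -
  have "t2 ^ j = t2 ^ (j-(2*r-1)) * t2 ^ (2*r-1)" "t2 ^ (j-(r-3)) = t2 ^ (j-(2*r-1)) * t2 ^ (r+2)"
    unfolding power_add[symmetric] by (rule arg_cong[where f = "power t2"], use assms in simp)+
  then show ?thesis by (simp only: Gs_def power_add[of s2] distrib_left) (simp only: mult_ac add_diff_cancel_right')
qed

text \<open>The counterpart for high x-degree shifts by r+2 and carries the factor r-3, so for r = 3
  the monomial lies in the ideal at once.\<close>

lemma Fs_reduction:
  assumes "r \<ge> 3" "2*r-1 \<le> i"
  shows "of_nat (2*r-1) * (s2 ^ i * t2 ^ j) = s2 ^ (i-(2*r-1)) * t2 ^ j * Fs r - of_nat (r-3) * (s2 ^ (i-(r+2)) * t2 ^ (j+(r+2)))"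
proof -
  have "s2 ^ i = s2 ^ (i-(2*r-1)) * s2 ^ (2*r-1)" "s2 ^ (i-(r+2)) = s2 ^ (i-(2*r-1)) * s2 ^ (r-3)"
    unfolding power_add[symmetric] by (rule arg_cong[where f = "power s2"], use assms in simp)+
  then show ?thesis by (simp only: Fs_def power_add[of t2] distrib_left) (simp only: mult_ac add_diff_cancel_right')
qed

lemma monom_in_ideal_xy_Gs:
  assumes "r \<ge> 3" "2*r-1 \<le> j" "s2 ^ (i+(r-3)) * t2 ^ (j-(r-3)) \<in> ideal_xy r"
  shows "s2 ^ i * t2 ^ j \<in> ideal_xy r"
proof (rule ideal_xy_of_nat_cancel)
  show "of_nat (2*r-1) * (s2 ^ i * t2 ^ j) \<in> ideal_xy r"
    unfolding Gs_reduction[OF assms(1,2)]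
    by (intro ideal_xy_diff ideal_xy_mult[OF ideal_xy_gens(2)] ideal_xy_mult[OF assms(3)])
qed (use assms in simp)

text \<open>A move by \<open>Gs r\<close> would reproduce the same monomial here. Instead
  \<open>Gs 3\<close> collapses to 10 y^5.\<close>

lemma monom_in_ideal_xy_3: "5 \<le> j \<Longrightarrow> s2 ^ i * t2 ^ j \<in> ideal_xy 3"
proof (rule ideal_xy_of_nat_cancel)
  assume "5 \<le> j"
  then have "of_nat 10 * (s2 ^ i * t2 ^ j) = (s2 ^ i * t2 ^ (j - 5)) * Gs 3"
    by (auto simp: Gs_def power_add algebra_simps dest!: le_Suc_ex)
  also have "\<dots> \<in> ideal_xy 3" by (rule ideal_xy_mult[OF ideal_xy_gens(2)])
  finally show "of_nat 10 * (s2 ^ i * t2 ^ j) \<in> ideal_xy 3" .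
qed simp

lemma monom_in_ideal_xy_Fs:
  assumes "r \<ge> 3" "2*r-1 \<le> i" "of_nat (r-3) * (s2 ^ (i-(r+2)) * t2 ^ (j+(r+2))) \<in> ideal_xy r"
  shows "s2 ^ i * t2 ^ j \<in> ideal_xy r"
proof (rule ideal_xy_of_nat_cancel)
  show "of_nat (2*r-1) * (s2 ^ i * t2 ^ j) \<in> ideal_xy r"
    unfolding Fs_reduction[OF assms(1,2)]
    by (intro ideal_xy_diff ideal_xy_mult[OF ideal_xy_gens(1)] assms(3))
qed (use assms in simp)

text \<open>This and the next three lemmas are the origin of the bound r: y^r brings both
  z-coefficients of f_x, and x^r both of f_y, into the ideal. Beyond the ideal only y^j f_x and x^i
  f_y with i, j < r matter.\<close>

lemma t2_Px_in_ideal_xy: "r \<ge> 3 \<Longrightarrow> t2 ^ r * Px r \<in> ideal_xy r"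
proof -
  assume r: "r \<ge> 3"
  have "s2 ^ (r-2) * t2 ^ (2*r-1) \<in> ideal_xy r"
  proof (cases "r = 3")
    case True
    then show ?thesis using monom_in_ideal_xy_3[of 5 1] by simp
  next
    case False
    show ?thesis by (rule monom_in_ideal_xy_Gs[OF r], simp, rule monom_in_ideal_xy) (use r False in auto)
  qed
  moreover have "t2 ^ r * Px r = of_nat (r-1) * (s2 ^ (r-2) * t2 ^ (2*r-1))"
  proof -
    have "t2 ^ (2*r-1) = t2 ^ r * t2 ^ (r-1)" unfolding power_add[symmetric] by (rule arg_cong) (use r in simp)
    then show ?thesis by (simp add: Px_def mult_ac)
  qed
  ultimately show ?thesis using ideal_xy_mult by simp
qed

lemma t2_Fx_in_ideal_xy: "r \<ge> 3 \<Longrightarrow> t2 ^ r * Fx r \<in> ideal_xy r"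
proof -
  assume r: "r \<ge> 3"
  have "of_nat (r-3) * (s2 ^ (r-4) * t2 ^ (2*r+2)) \<in> ideal_xy r"
  proof (cases "r = 3")
    case True
    then show ?thesis using ideal_xy_mult[OF ideal_xy_gens(1), of 0] by simp
  next
    case False
    \<comment> \<open>\<open>step\<close> and \<open>step2\<close> are one and two moves by
      \<open>Gs r\<close>. Starting at x^(r-4), k moves reach x^(r-1) if k (r-3) is at least 3:
      three moves for r = 4, two for r = 5, one from r = 6 on.\<close>
    have step: "s2 ^ i * t2 ^ j \<in> ideal_xy r" if "2*r-1 \<le> j" "r-1 \<le> i + (r-3)" for i j
      by (rule monom_in_ideal_xy_Gs[OF r that(1)], rule monom_in_ideal_xy) (use r that in auto)
    have step2: "s2 ^ i * t2 ^ j \<in> ideal_xy r" if "3*r-4 \<le> j" "r-1 \<le> i + 2*(r-3)" for i j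
      by (rule monom_in_ideal_xy_Gs[OF r], (use r that in simp), rule step) (use r that in auto)
    have "s2 ^ (r-4) * t2 ^ (2*r+2) \<in> ideal_xy r"
    proof (cases "r \<le> 5")
      case True
      with False r consider "r = 4" | "r = 5" by linarith
      then show ?thesis
      proof cases
        case 1
        show ?thesis by (rule monom_in_ideal_xy_Gs[OF r], simp, rule step2) (simp_all add: 1)
      qed (rule step2, auto)
    qed (rule step, auto)
    then show ?thesis by (rule ideal_xy_mult)
  qed
  moreover have "t2 ^ r * Fx r = of_nat (2*r-1) * (s2 ^ (2*r-2) * t2 ^ r) + of_nat (r-3) * (s2 ^ (r-4) * t2 ^ (2*r+2))"
    by (simp only: Fx_def power_add mult_2[of r] distrib_left) (simp only: mult_ac)
  ultimately show ?thesis using r by (auto intro!: ideal_xy_add ideal_xy_mult[OF monom_in_ideal_xy])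
qed

lemma s2_Py_in_ideal_xy: "r \<ge> 3 \<Longrightarrow> s2 ^ r * Py r \<in> ideal_xy r"
proof -
  assume r: "r \<ge> 3"
  have "s2 ^ (2*r-1) * t2 ^ (r-2) \<in> ideal_xy r"
  proof (rule monom_in_ideal_xy_Fs[OF r])
    \<comment> \<open>The target of one move by \<open>Fs r\<close>. From x^(r-3) it takes two moves
      by \<open>Gs r\<close> for r = 4 and one for larger r; for r = 3 the factor r-3
      vanishes.\<close>
    have e: "s2 ^ (2*r-1-(r+2)) * t2 ^ (r-2+(r+2)) = s2 ^ (r-3) * t2 ^ (2*r)"
      using r by (intro arg_cong2[where f = "(*)"] arg_cong2[where f = power]) auto
    have step: "s2 ^ i * t2 ^ j \<in> ideal_xy r" if "2*r-1 \<le> j" "r-1 \<le> i + (r-3)" for i j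
      by (rule monom_in_ideal_xy_Gs[OF r that(1)], rule monom_in_ideal_xy) (use r that in auto)
    show "of_nat (r-3) * (s2 ^ (2*r-1-(r+2)) * t2 ^ (r-2+(r+2))) \<in> ideal_xy r"
    proof (cases "r \<le> 4")
      case True
      with r consider "r = 3" | "r = 4" by linarith
      then show ?thesis unfolding e
      proof cases
        case 1
        then show "of_nat (r-3) * (s2 ^ (r-3) * t2 ^ (2*r)) \<in> ideal_xy r" using ideal_xy_mult[OF ideal_xy_gens(1), of 0] by simp
      next
        case 2
        have "s2 ^ 1 * t2 ^ 8 \<in> ideal_xy r" by (rule monom_in_ideal_xy_Gs[OF r], (simp add: 2), rule step) (simp_all add: 2)
        then show "of_nat (r-3) * (s2 ^ (r-3) * t2 ^ (2*r)) \<in> ideal_xy r" by (simp add: 2)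
      qed
    next
      case False
      show ?thesis unfolding e by (rule ideal_xy_mult, rule step) (use False in auto)
    qed
  qed simp
  moreover have "s2 ^ r * Py r = of_nat (r-1) * (s2 ^ (2*r-1) * t2 ^ (r-2))"
  proof -
    have "s2 ^ (2*r-1) = s2 ^ r * s2 ^ (r-1)" unfolding power_add[symmetric] by (rule arg_cong) (use r in simp)
    then show ?thesis by (simp add: Py_def mult_ac)
  qed
  ultimately show ?thesis using ideal_xy_mult by simp
qed

lemma s2_Fy_in_ideal_xy: "r \<ge> 3 \<Longrightarrow> s2 ^ r * Fy r \<in> ideal_xy r"
proof -
  assume r: "r \<ge> 3"
  have "s2 ^ r * Fy r = of_nat (2*r-1) * (s2 ^ r * t2 ^ (2*r-2)) + of_nat (r+2) * (s2 ^ (r+(r-3)) * t2 ^ (r+1))"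
    by (simp only: Fy_def power_add distrib_left mult_ac)
  also have "\<dots> \<in> ideal_xy r" by (intro ideal_xy_add ideal_xy_mult monom_in_ideal_xy) (use r in simp_all)
  finally show ?thesis .
qed

text \<open>Division by the ideal (x, y^n). For n = r, multiples of x and of y^r turn
  \<open>Fx r\<close> and \<open>Px r\<close> into elements of \<open>ideal_xy r\<close>, so only
  the remainder \<open>L\<close> counts as a factor of f_x.\<close>

lemma poly2_split_s2:
  "\<exists>L p' p''. p = L + s2 * p' + t2 ^ n * p'' \<and> (\<forall>i j. cf L i j = (if i = 0 \<and> j < n then cf p 0 j else 0))"
proof -
  let ?q = "map_poly (\<lambda>q. [:coeff q 0:]) p"
  have q: "cf ?q i j = (if i = 0 then cf p 0 j else 0)" for i j
    by (simp add: cf_def coeff_map_poly coeff_pCons split: nat.splits)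
  have L: "cf (poly_cutoff n ?q) i j = (if i = 0 \<and> j < n then cf p 0 j else 0)" for i j
    using q[of i j] by (auto simp: cf_def coeff_poly_cutoff)
  have p': "cf (s2 * map_poly (poly_shift 1) p) i j = (if 1 \<le> i then cf p i j else 0)" for i j
    using cf_monom_mult[of 1 0 "map_poly (poly_shift 1) p" i j] by (simp add: cf_def coeff_map_poly coeff_poly_shift)
  have p'': "cf (t2 ^ n * poly_shift n ?q) i j = (if i = 0 \<and> n \<le> j then cf p 0 j else 0)" for i j
    using cf_monom_mult[of 0 n "poly_shift n ?q" i j] q[of i j] by (auto simp: cf_def coeff_poly_shift)
  have "p = poly_cutoff n ?q + s2 * map_poly (poly_shift 1) p + t2 ^ n * poly_shift n ?q"
    by (rule poly2_eqI) (simp only: L p' p'' cf_add, auto simp: not_less_eq_eq)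
  then show ?thesis using L by blast
qed

lemma poly2_split_t2:
  "\<exists>L p' p''. p = L + t2 * p' + s2 ^ n * p'' \<and> (\<forall>i j. cf L i j = (if j = 0 \<and> i < n then cf p i 0 else 0))"
proof -
  let ?q = "coeff p 0"
  have L: "cf [:poly_cutoff n ?q:] i j = (if j = 0 \<and> i < n then cf p i 0 else 0)" for i j
    by (simp add: cf_def coeff_poly_cutoff coeff_pCons split: nat.splits)
  have p': "cf (t2 * poly_shift 1 p) i j = (if 1 \<le> j then cf p i j else 0)" for i j
    using cf_monom_mult[of 0 1 "poly_shift 1 p" i j] by (simp add: cf_def coeff_poly_shift)
  have p'': "cf (s2 ^ n * [:poly_shift n ?q:]) i j = (if j = 0 \<and> n \<le> i then cf p i 0 else 0)" for i j
    using cf_monom_mult[of n 0 "[:poly_shift n ?q:]" i j]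
    by (simp add: cf_def coeff_poly_shift coeff_pCons split: nat.splits)
  have "p = [:poly_cutoff n ?q:] + t2 * poly_shift 1 p + s2 ^ n * [:poly_shift n ?q:]"
    by (rule poly2_eqI) (simp only: L p' p'' cf_add, auto simp: not_less_eq_eq)
  then show ?thesis using L by blast
qed

lemma s2_factor:
  assumes "\<And>j. cf p 0 j = 0"
  shows "\<exists>p'. p = s2 * p' \<and> (\<forall>i j. cf p' i j = cf p (Suc i) j)"
proof (intro exI conjI allI)
  let ?p = "map_poly (poly_shift 1) p"
  show p': "cf ?p i j = cf p (Suc i) j" for i j
    by (simp add: cf_def coeff_map_poly coeff_poly_shift)
  have "cf (s2 * ?p) i j = cf p i j" for i j
    using cf_monom_mult[of 1 0 ?p i j] p'[of "i-1" j] assms[of j] by (cases i) auto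
  then show "p = s2 * ?p" by (intro poly2_eqI) simp
qed

lemma t2_factor:
  assumes "\<And>i. cf p i 0 = 0"
  shows "\<exists>p'. p = t2 * p' \<and> (\<forall>i j. cf p' i j = cf p i (Suc j))"
proof (intro exI conjI allI)
  let ?p = "poly_shift 1 p"
  show p': "cf ?p i j = cf p i (Suc j)" for i j
    by (simp add: cf_def coeff_poly_shift)
  have "cf (t2 * ?p) i j = cf p i j" for i j
    using cf_monom_mult[of 0 1 ?p i j] p'[of i "j-1"] assms[of i] by (cases j) auto
  then show "p = t2 * ?p" by (intro poly2_eqI) simp
qed

text \<open>The complement of \<open>ideal_xy r\<close> without the 2 r top terms x^(r-2) y^(r-1+j)
  and x^(r-1+i) y^(r-2), i, j < r. Outside the two rectangles this leaves only the corner (r-2,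
  r-2).\<close>

definition normal_exps :: "nat \<Rightarrow> (nat \<times> nat) set" where
  "normal_exps r = {..r-3} \<times> {..2*r-2} \<union> {..2*r-2} \<times> {..r-3} \<union> {(r-2, r-2)}"

lemma mem_normal_exps: "(i, j) \<in> normal_exps r \<longleftrightarrow> i \<le> r-3 \<and> j \<le> 2*r-2 \<or> i \<le> 2*r-2 \<and> j \<le> r-3 \<or> i = r-2 \<and> j = r-2"
  by (auto simp: normal_exps_def)

lemma normal_exps_bounds:
  assumes "(i, j) \<in> normal_exps r" "r \<ge> 3"
  shows "(i \<le> r-2 \<and> j \<le> 2*r-2) \<or> (j \<le> r-2 \<and> i \<le> 2*r-2)"
proof -
  have "i \<le> r-3 \<Longrightarrow> i \<le> r-2" "j \<le> r-3 \<Longrightarrow> j \<le> r-2" "r-2 \<le> 2*r-2" using assms(2) by linarith+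
  then show ?thesis using assms(1) unfolding mem_normal_exps by blast
qed

section \<open>Syzygies and their minimal degree\<close>

lemma coeff_syzygy:
  fixes a b c :: poly3 and r :: nat
  defines "u \<equiv> a * dx (curve r) + b * dy (curve r) + c * dz (curve r)"
  shows "coeff u 0 = coeff a 0 * Fx r + coeff b 0 * Fy r - coeff c 0 * Mxy r"
    and "coeff u (Suc l) = (coeff a (Suc l) * Fx r + coeff b (Suc l) * Fy r)
      - (coeff a l * Px r + coeff b l * Py r) - coeff c (Suc l) * Mxy r"
proof -
  have mult: "coeff (a * [:p, q:]) 0 = coeff a 0 * p"
     "coeff (a * [:p, q:]) (Suc l) = coeff a (Suc l) * p + coeff a l * q" for a :: poly3 and p q l
    by (simp_all add: mult_pCons_right)
  show "coeff u 0 = coeff a 0 * Fx r + coeff b 0 * Fy r - coeff c 0 * Mxy r"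
    unfolding u_def dx_curve dy_curve dz_curve by (simp add: mult)
  show "coeff u (Suc l) = (coeff a (Suc l) * Fx r + coeff b (Suc l) * Fy r)
      - (coeff a l * Px r + coeff b l * Py r) - coeff c (Suc l) * Mxy r"
    unfolding u_def dx_curve dy_curve dz_curve by (simp add: mult algebra_simps)
qed

text \<open>Descending induction on the power of z. If the boundary entries of a and b vanish at
  level l+1, then the coefficient of u at level l+1 plus the boundary parts of level l times
  \<open>Px r\<close> and \<open>Py r\<close> lies in \<open>ideal_xy r\<close>, yet is supported on
  the complement, so it is 0. The supports are disjoint, so each part is 0. With u = 0 this
  constrains syzygies; with u a combination of normal monomials it shows their independence modulo
  the Jacobian ideal.\<close>

lemma syzygy_boundary:
  assumes r: "r \<ge> 3" and eq: "u = a * dx (curve r) + b * dy (curve r) + c * dz (curve r)"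
    and supp: "\<And>l i j. cf (coeff u l) i j \<noteq> 0 \<Longrightarrow> (i, j) \<in> normal_exps r"
  shows "u = 0" and "j < r \<Longrightarrow> cf (coeff a l) 0 j = 0" and "i < r \<Longrightarrow> cf (coeff b l) i 0 = 0"
proof -
  note u0 = coeff_syzygy(1)[of a r b c, folded eq] and uS = coeff_syzygy(2)[of a r b c, folded eq]
  define V where "V l \<longleftrightarrow> (\<forall>j<r. cf (coeff a l) 0 j = 0) \<and> (\<forall>i<r. cf (coeff b l) i 0 = 0)" for l
  have inH: "coeff a l * Fx r + coeff b l * Fy r \<in> ideal_xy r" if V: "V l" for l
  proof -
    obtain L p' p'' where a: "coeff a l = L + s2 * p' + t2 ^ r * p''"
      "\<forall>i j. cf L i j = (if i = 0 \<and> j < r then cf (coeff a l) 0 j else 0)" using poly2_split_s2 by blast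
    have L: "L = 0" by (rule poly2_eqI) (use a(2) V in \<open>auto simp: V_def\<close>)
    obtain L' q' q'' where b: "coeff b l = L' + t2 * q' + s2 ^ r * q''"
      "\<forall>i j. cf L' i j = (if j = 0 \<and> i < r then cf (coeff b l) i 0 else 0)" using poly2_split_t2 by blast
    have L': "L' = 0" by (rule poly2_eqI) (use b(2) V in \<open>auto simp: V_def\<close>)
    have "coeff a l * Fx r + coeff b l * Fy r =
       p' * (s2 * Fx r) + p'' * (t2 ^ r * Fx r) + (q' * (t2 * Fy r) + q'' * (s2 ^ r * Fy r))"
      unfolding a b L L' by (simp add: algebra_simps)
    also have "\<dots> \<in> ideal_xy r"
      unfolding s2_Fx[OF r] t2_Fy[OF r]
      by (intro ideal_xy_add ideal_xy_mult ideal_xy_gens t2_Fx_in_ideal_xy s2_Fy_in_ideal_xy r)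
    finally show ?thesis .
  qed
  have step: "V l \<and> coeff u (Suc l) = 0" if V: "V (Suc l)" for l
  proof -
    obtain L p' p'' where a: "coeff a l = L + s2 * p' + t2 ^ r * p''"
      and L: "\<forall>i j. cf L i j = (if i = 0 \<and> j < r then cf (coeff a l) 0 j else 0)" using poly2_split_s2 by blast
    obtain L' q' q'' where b: "coeff b l = L' + t2 * q' + s2 ^ r * q''"
      and L': "\<forall>i j. cf L' i j = (if j = 0 \<and> i < r then cf (coeff b l) i 0 else 0)" using poly2_split_t2 by blast
    define h where "h = coeff u (Suc l) + L * Px r + L' * Py r"
    have "h = (coeff a (Suc l) * Fx r + coeff b (Suc l) * Fy r)
       - (p' * (s2 * Px r) + p'' * (t2 ^ r * Px r) + (q' * (t2 * Py r) + q'' * (s2 ^ r * Py r)) + coeff c (Suc l) * Mxy r)"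
      unfolding h_def uS a b by (simp add: algebra_simps)
    also have "\<dots> \<in> ideal_xy r"
      unfolding s2_Px[OF r] t2_Py[OF r]
      by (intro ideal_xy_diff ideal_xy_add inH[OF V] ideal_xy_mult ideal_xy_gens t2_Px_in_ideal_xy s2_Py_in_ideal_xy r)
    finally obtain a' b' c' where h: "h = a' * Fs r + b' * Gs r + c' * Mxy r" by (auto simp: ideal_xy_def)
    \<comment> \<open>\<open>L\<close> involves only y^j with j < r, so \<open>L * Px r\<close>
      occupies just the monomials x^(r-2) y^(r-1+j), all outside \<open>normal_exps r\<close>;
      likewise for \<open>L'\<close>. Every coefficient can therefore be read off
      separately.\<close>
    have cfh: "cf h i j = cf (coeff u (Suc l)) i j
       + of_nat (r-1) * (if i = r-2 \<and> r-1 \<le> j \<and> j < r+(r-1) then cf (coeff a l) 0 (j-(r-1)) else 0)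
       + of_nat (r-1) * (if j = r-2 \<and> r-1 \<le> i \<and> i < r+(r-1) then cf (coeff b l) (i-(r-1)) 0 else 0)" for i j
    proof -
      have "L * Px r = of_nat (r-1) * (s2 ^ (r-2) * t2 ^ (r-1) * L)"
           "L' * Py r = of_nat (r-1) * (s2 ^ (r-1) * t2 ^ (r-2) * L')"
        by (simp_all only: Px_def Py_def mult_ac)
      then have "cf h i j = cf (coeff u (Suc l)) i j
       + of_nat (r-1) * (if r-2 \<le> i \<and> r-1 \<le> j then cf L (i-(r-2)) (j-(r-1)) else 0)
       + of_nat (r-1) * (if r-1 \<le> i \<and> r-2 \<le> j then cf L' (i-(r-1)) (j-(r-2)) else 0)"
        by (simp only: h_def cf_add cf_of_nat cf_monom_mult)
      moreover have "(if r-2 \<le> i \<and> r-1 \<le> j then cf L (i-(r-2)) (j-(r-1)) else 0) =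
         (if i = r-2 \<and> r-1 \<le> j \<and> j < r+(r-1) then cf (coeff a l) 0 (j-(r-1)) else 0)"
        using r by (simp add: L) linarith
      moreover have "(if r-1 \<le> i \<and> r-2 \<le> j then cf L' (i-(r-1)) (j-(r-2)) else 0) =
         (if j = r-2 \<and> r-1 \<le> i \<and> i < r+(r-1) then cf (coeff b l) (i-(r-1)) 0 else 0)"
        using r by (simp add: L') linarith
      ultimately show ?thesis by simp
    qed
    have "(i \<le> r-2 \<and> j \<le> 2*r-2) \<or> (j \<le> r-2 \<and> i \<le> 2*r-2)" if "cf h i j \<noteq> 0" for i j
    proof -
      from that have "(i, j) \<in> normal_exps r \<or> (i = r-2 \<and> r-1 \<le> j \<and> j < r+(r-1)) \<or> (j = r-2 \<and> r-1 \<le> i \<and> i < r+(r-1))"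
        using supp[of "Suc l" i j] unfolding cfh by (auto split: if_splits)
      then show ?thesis
      proof (elim disjE)
        assume "i = r-2 \<and> r-1 \<le> j \<and> j < r+(r-1)"
        then have "i \<le> r-2 \<and> j \<le> 2*r-2" using r by linarith
        then show ?thesis ..
      next
        assume "j = r-2 \<and> r-1 \<le> i \<and> i < r+(r-1)"
        then have "j \<le> r-2 \<and> i \<le> 2*r-2" using r by linarith
        then show ?thesis ..
      qed (rule normal_exps_bounds[OF _ r])
    qed
    from ideal_xy_normal_exps(1)[OF r h this] have h0: "h = 0" by blast
    have nz: "of_nat (r-1) \<noteq> (0::complex)" using r unfolding of_nat_eq_0_iff by simp
    have a0: "cf (coeff a l) 0 j = 0" if "j < r" for j
    proof -
      have n: "\<not> r-2 \<le> r-3" "\<not> j+(r-1) \<le> r-3" "j+(r-1) \<noteq> r-2" and c: "r-1 \<le> j+(r-1)" "j+(r-1) < r+(r-1)"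
        using r that by linarith+
      then have "cf (coeff u (Suc l)) (r-2) (j+(r-1)) = 0"
        using supp[of "Suc l" "r-2" "j+(r-1)"] unfolding mem_normal_exps by blast
      then have "of_nat (r-1) * cf (coeff a l) 0 j = 0" using cfh[of "r-2" "j+(r-1)"] n c unfolding h0
        by (simp only: cf_0 add_diff_cancel_right' simp_thms if_True if_False mult_zero_right add_0_left add_0_right)
      then show ?thesis using nz by (simp only: mult_eq_0_iff simp_thms)
    qed
    moreover have b0: "cf (coeff b l) i 0 = 0" if "i < r" for i
    proof -
      have n: "\<not> r-2 \<le> r-3" "\<not> i+(r-1) \<le> r-3" "i+(r-1) \<noteq> r-2" and c: "r-1 \<le> i+(r-1)" "i+(r-1) < r+(r-1)"
        using r that by linarith+
      then have "cf (coeff u (Suc l)) (i+(r-1)) (r-2) = 0"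
        using supp[of "Suc l" "i+(r-1)" "r-2"] unfolding mem_normal_exps by blast
      then have "of_nat (r-1) * cf (coeff b l) i 0 = 0" using cfh[of "i+(r-1)" "r-2"] n c unfolding h0
        by (simp only: cf_0 add_diff_cancel_right' simp_thms if_True if_False mult_zero_right add_0_left add_0_right)
      then show ?thesis using nz by (simp only: mult_eq_0_iff simp_thms)
    qed
    moreover have "coeff u (Suc l) = 0"
    proof (rule poly2_eqI)
      fix i j
      have "(if i = r-2 \<and> r-1 \<le> j \<and> j < r+(r-1) then cf (coeff a l) 0 (j-(r-1)) else 0) = 0"
           "(if j = r-2 \<and> r-1 \<le> i \<and> i < r+(r-1) then cf (coeff b l) (i-(r-1)) 0 else 0) = 0"
        using a0[of "j-(r-1)"] b0[of "i-(r-1)"] by auto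
      with cfh[of i j] show "cf (coeff u (Suc l)) i j = cf 0 i j"
        unfolding h0 by (simp only: cf_0 mult_zero_right add_0_right)
    qed
    ultimately show ?thesis by (simp add: V_def)
  qed
  \<comment> \<open>Beyond both degrees all coefficients are 0, which starts the descent.\<close>
  define N where "N = Suc (max (degree a) (degree b))"
  have VN: "V (N - n)" for n
  proof (induction n)
    case 0
    show ?case by (simp add: V_def N_def coeff_eq_0)
  next
    case (Suc n)
    then show ?case using step[of "N - Suc n"] by (cases "n < N") (auto simp: Suc_diff_Suc)
  qed
  have V: "V l" for l
  proof (cases "l \<le> N")
    case True
    then show ?thesis using VN[of "N - l"] by simp
  next
    case False
    then show ?thesis by (simp add: V_def N_def coeff_eq_0)
  qed
  then show "j < r \<Longrightarrow> cf (coeff a l) 0 j = 0" "i < r \<Longrightarrow> cf (coeff b l) i 0 = 0"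
    by (auto simp: V_def)
  have "coeff u 0 \<in> ideal_xy r"
    unfolding u0 by (intro ideal_xy_diff inH V ideal_xy_mult ideal_xy_gens)
  then obtain a' b' c' where h: "coeff u 0 = a' * Fs r + b' * Gs r + c' * Mxy r" by (auto simp: ideal_xy_def)
  have "(i \<le> r-2 \<and> j \<le> 2*r-2) \<or> (j \<le> r-2 \<and> i \<le> 2*r-2)" if "cf (coeff u 0) i j \<noteq> 0" for i j
    by (rule normal_exps_bounds[OF supp[OF that] r])
  from ideal_xy_normal_exps(1)[OF r h this] have "coeff u 0 = 0" by blast
  show "u = 0"
  proof (rule poly_eqI)
    fix l show "coeff u l = coeff 0 l" using step[of "l-1"] V \<open>coeff u 0 = 0\<close> by (cases l) auto
  qed
qed

lemma mdr_curve:
  assumes r: "r \<ge> 3"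
  shows "mdr (curve r) = r"
  unfolding mdr_def
proof (rule Least_equality)
  \<comment> \<open>\<open>Gs r\<close> is divisible by y^(r-1), so x^(r-1) y f_y is a multiple of
    \<open>Mxy r\<close>, hence of f_z. This yields a syzygy of degree r with first entry 0.\<close>
  let ?b = "[:s2 ^ (r-1) * t2:]"
  let ?c = "[:of_nat (2*r-1) * t2 ^ r + of_nat (r+2) * (s2 ^ (r-3) * t2 ^ 3), - (of_nat (r-1) * s2 ^ (r-1)):]"
  have "s2 ^ (r-1) * t2 * Fy r = Mxy r * (of_nat (2*r-1) * t2 ^ r + of_nat (r+2) * (s2 ^ (r-3) * t2 ^ 3))"
  proof -
    have "s2 ^ (r-1) * t2 * Fy r = s2 ^ (r-1) * (t2 * Fy r)" by (simp add: mult_ac)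
    also have "\<dots> = s2 ^ (r-1) * Gs r" by (simp only: t2_Fy[OF r])
    also have "Gs r = t2 ^ (r-1) * (of_nat (2*r-1) * t2 ^ r + of_nat (r+2) * (s2 ^ (r-3) * t2 ^ 3))"
    proof -
      have "t2 ^ (2*r-1) = t2 ^ (r-1) * t2 ^ r" "t2 ^ (r+2) = t2 ^ (r-1) * t2 ^ 3"
        unfolding power_add[symmetric] by (rule arg_cong[where f = "power t2"], use r in simp)+
      then show ?thesis by (simp only: Gs_def distrib_left mult_ac)
    qed
    finally show ?thesis by (simp only: Mxy_def mult_ac)
  qed
  moreover have "s2 ^ (r-1) * t2 * Py r = Mxy r * (of_nat (r-1) * s2 ^ (r-1))"
  proof -
    have "s2 ^ (r-1) * t2 * Py r = s2 ^ (r-1) * (t2 * Py r)" by (simp add: mult_ac)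
    then show ?thesis unfolding t2_Py[OF r] by (simp only: mult_ac)
  qed
  ultimately have "0 * dx (curve r) + ?b * dy (curve r) + ?c * dz (curve r) = 0"
    unfolding dx_curve dy_curve dz_curve by (simp del: of_nat_diff of_nat_add add: mult.commute)
  moreover have "homogeneous3 r ?b"
    using homogeneous2_monom'[of "r-1" 1 r] r by (intro homogeneous3_pCons[of r _ 0, simplified]) (auto simp: homogeneous2_def)
  moreover have "homogeneous3 r ?c"
  proof (intro homogeneous3_pCons homogeneous2_add homogeneous2_of_nat)
    show "homogeneous2 r (t2 ^ r)" "homogeneous2 (r-1) (- (of_nat (r-1) * s2 ^ (r-1)))"
      unfolding homogeneous2_minus
      using homogeneous2_monom'[of 0 r r] homogeneous2_of_nat[OF homogeneous2_monom'[of "r-1" 0 "r-1"]] by simp_all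
    show "homogeneous2 r (s2 ^ (r-3) * t2 ^ 3)" by (rule homogeneous2_monom') (use r in simp)
  qed (use r in simp)
  moreover have "?b \<noteq> 0" by simp
  moreover have "homogeneous3 r 0" by (simp add: homogeneous3_def)
  ultimately show "\<exists>a b c. (a, b, c) \<in> AR (curve r) \<and> (a, b, c) \<noteq> (0, 0, 0) \<and>
      homogeneous3 r a \<and> homogeneous3 r b \<and> homogeneous3 r c"
    unfolding AR_def by (intro exI[of _ 0] exI[of _ ?b] exI[of _ ?c]) auto
next
  fix k assume "\<exists>a b c. (a, b, c) \<in> AR (curve r) \<and> (a, b, c) \<noteq> (0, 0, 0) \<and>
      homogeneous3 k a \<and> homogeneous3 k b \<and> homogeneous3 k c"
  then obtain a b c where eq: "0 = a * dx (curve r) + b * dy (curve r) + c * dz (curve r)"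
    and nz: "(a, b, c) \<noteq> (0, 0, 0)" and hom: "homogeneous3 k a" "homogeneous3 k b"
    by (auto simp: AR_def)
  show "r \<le> k"
  proof (rule ccontr)
    assume "\<not> r \<le> k"
    then have k: "k < r" by simp
    have a0: "cf (coeff a l) 0 j = 0" if "j < r" for l j by (rule syzygy_boundary(2)[OF r eq _ that]) simp
    have b0: "cf (coeff b l) i 0 = 0" if "i < r" for l i by (rule syzygy_boundary(3)[OF r eq _ that]) simp
    have deg_a: "i + j + l = k" if "cf (coeff a l) i j \<noteq> 0" for i j l
      using hom(1) that by (auto simp: homogeneous3_def cf_def)
    have deg_b: "i + j + l = k" if "cf (coeff b l) i j \<noteq> 0" for i j l
      using hom(2) that by (auto simp: homogeneous3_def cf_def)
    \<comment> \<open>In degree k < r all pure powers of y in a and of x in b are boundary entries,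
      so x divides a and y divides b. The quotients have degree at most r-2, too low for a
      nontrivial relation of \<open>Fs r\<close> and \<open>Gs r\<close> modulo
      \<open>Mxy r\<close>.\<close>
    have ab: "coeff a l = 0 \<and> coeff b l = 0" for l
    proof -
      have "cf (coeff a l) 0 j = 0" for j using a0[of j l] deg_a[of l 0 j] k by fastforce
      then obtain a' where a': "coeff a l = s2 * a'" "\<And>i j. cf a' i j = cf (coeff a l) (Suc i) j"
        using s2_factor by blast
      have "cf (coeff b l) i 0 = 0" for i using b0[of i l] deg_b[of l i 0] k by fastforce
      then obtain b' where b': "coeff b l = t2 * b'" "\<And>i j. cf b' i j = cf (coeff b l) i (Suc j)"
        using t2_factor by blast
      have sP: "coeff a n * Px r + coeff b n * Py r \<in> range (\<lambda>p. p * Mxy r)" for n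
      proof -
        have "cf (coeff a n) 0 j = 0" for j using a0[of j n] deg_a[of n 0 j] k by fastforce
        then obtain a' where a': "coeff a n = s2 * a'" using s2_factor by blast
        have "cf (coeff b n) i 0 = 0" for i using b0[of i n] deg_b[of n i 0] k by fastforce
        then obtain b' where b': "coeff b n = t2 * b'" using t2_factor by blast
        have "coeff a n * Px r + coeff b n * Py r = a' * (s2 * Px r) + b' * (t2 * Py r)"
          by (simp add: a' b' mult_ac)
        then have "coeff a n * Px r + coeff b n * Py r = ((a' + b') * of_nat (r-1)) * Mxy r"
          unfolding s2_Px[OF r] t2_Py[OF r] by (simp only: distrib_right mult.assoc)
        then show ?thesis by blast
      qed
      have FG: "coeff a l * Fx r + coeff b l * Fy r = a' * Fs r + b' * Gs r"
        by (simp add: a' b' mult_ac flip: s2_Fx[OF r] t2_Fy[OF r])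
      have "\<exists>c'. 0 = a' * Fs r + b' * Gs r + c' * Mxy r"
      proof (cases l)
        case 0
        then show ?thesis using coeff_syzygy(1)[of a r b c, folded eq] FG
          by (intro exI[of _ "- coeff c 0"]) simp
      next
        case (Suc n)
        obtain p where "coeff a n * Px r + coeff b n * Py r = p * Mxy r" using sP by blast
        then show ?thesis using coeff_syzygy(2)[of a r b c n, folded eq] FG Suc
          by (intro exI[of _ "- coeff c l - p"]) (simp add: algebra_simps)
      qed
      then obtain c' where c': "0 = a' * Fs r + b' * Gs r + c' * Mxy r" by blast
      have "cf a' i j = 0" for i j
        using ideal_xy_normal_exps(2)[OF r c', of j i] deg_a[of l "Suc i" j] k a'(2)[of i j] by fastforce
      then have "a' = 0" by (intro poly2_eqI) simp
      moreover have "cf b' i j = 0" for i j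
        using ideal_xy_normal_exps(3)[OF r c' _ \<open>a' = 0\<close>, of i j] deg_b[of l i "Suc j"] k b'(2)[of i j] by fastforce
      then have "b' = 0" by (intro poly2_eqI) simp
      ultimately show ?thesis by (simp add: a' b')
    qed
    then have "a = 0" "b = 0" by (auto intro: poly_eqI)
    moreover have "dz (curve r) \<noteq> 0" by (simp add: dz_curve Mxy_def)
    ultimately show False using eq nz by auto
  qed
qed

section \<open>The global Tjurina number\<close>

lemma jacobian_ideal_0: "0 \<in> jacobian_ideal f"
  unfolding jacobian_ideal_def by (auto intro!: exI[of _ 0])

lemma jacobian_ideal_add: "p \<in> jacobian_ideal f \<Longrightarrow> q \<in> jacobian_ideal f \<Longrightarrow> p + q \<in> jacobian_ideal f"
proof -
  assume "p \<in> jacobian_ideal f" "q \<in> jacobian_ideal f"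
  then obtain a b c a' b' c' where "p = a * dx f + b * dy f + c * dz f" "q = a' * dx f + b' * dy f + c' * dz f"
    by (auto simp: jacobian_ideal_def)
  then have "p + q = (a+a') * dx f + (b+b') * dy f + (c+c') * dz f" by (simp add: algebra_simps)
  then show ?thesis unfolding jacobian_ideal_def by blast
qed

lemma jacobian_ideal_mult: "p \<in> jacobian_ideal f \<Longrightarrow> q * p \<in> jacobian_ideal f"
proof -
  assume "p \<in> jacobian_ideal f"
  then obtain a b c where "p = a * dx f + b * dy f + c * dz f"
    by (auto simp: jacobian_ideal_def)
  then have "q * p = (q*a) * dx f + (q*b) * dy f + (q*c) * dz f" by (simp add: algebra_simps)
  then show ?thesis unfolding jacobian_ideal_def by blast
qed

lemma jacobian_ideal_subspace: "S.subspace (jacobian_ideal f)"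
  by (simp add: S.subspace_def jacobian_ideal_0 jacobian_ideal_add scale3_def jacobian_ideal_mult)

lemma jacobian_ideal_gens: "dx f \<in> jacobian_ideal f" "dy f \<in> jacobian_ideal f" "dz f \<in> jacobian_ideal f"
proof -
  have "dx f = 1 * dx f + 0 * dy f + 0 * dz f" "dy f = 0 * dx f + 1 * dy f + 0 * dz f"
    "dz f = 0 * dx f + 0 * dy f + 1 * dz f" by simp_all
  then show "dx f \<in> jacobian_ideal f" "dy f \<in> jacobian_ideal f" "dz f \<in> jacobian_ideal f"
    unfolding jacobian_ideal_def by blast+
qed

text \<open>This makes \<open>quotient_dim\<close> well defined. Each b in \<open>B\<close> gets a
  representative in the span of \<open>B'\<close> modulo \<open>W\<close>. A relation among the
  representatives puts the same combination of \<open>B\<close> into \<open>W\<close>, so it is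
  trivial: the choice is injective with independent image, and the exchange lemma bounds its
  size.\<close>

lemma basis_mod_card_le:
  assumes W: "S.subspace W" and B: "finite B" "basis_mod B V W" and B': "finite B'" "basis_mod B' V W"
  shows "card B \<le> card B'"
proof -
  have "\<forall>b\<in>B. \<exists>u\<in>S.span B'. b - u \<in> W" using B(2) B'(2) unfolding basis_mod_def by blast
  then obtain h where h: "\<And>b. b \<in> B \<Longrightarrow> h b \<in> S.span B'" "\<And>b. b \<in> B \<Longrightarrow> b - h b \<in> W" by metis
  have zero: "c b = 0" if c: "(\<Sum>b\<in>B. scale3 (c b) (h b)) = 0" and "b \<in> B" for c b
  proof -
    have "(\<Sum>b\<in>B. scale3 (c b) b) = (\<Sum>b\<in>B. scale3 (c b) (b - h b))"
      using c by (simp add: S.scale_right_diff_distrib sum_subtractf)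
    also have "\<dots> \<in> W" by (intro S.subspace_sum S.subspace_scale W h)
    finally have "(\<Sum>b\<in>B. scale3 (c b) b) \<in> S.span B \<inter> W"
      by (auto intro: S.span_sum S.span_scale S.span_base)
    then have "(\<Sum>b\<in>B. scale3 (c b) b) = 0" using B(2) unfolding basis_mod_def by blast
    then show "c b = 0" using B \<open>b \<in> B\<close> S.dependent_finite[OF B(1)] unfolding basis_mod_def by blast
  qed
  have inj: "inj_on h B"
  proof (rule inj_onI, rule ccontr)
    fix x y assume xy: "x \<in> B" "y \<in> B" "h x = h y" "x \<noteq> y"
    define c where "c b = (if b = x then 1 else if b = y then - 1 else (0::complex))" for b
    have "(\<Sum>b\<in>B. scale3 (c b) (h b)) = (\<Sum>b\<in>{x,y}. scale3 (c b) (h b))"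
      using xy B(1) by (intro sum.mono_neutral_right) (auto simp: c_def)
    also have "\<dots> = 0" using xy by (simp add: c_def)
    finally show False using zero[of c x] xy by (simp add: c_def)
  qed
  have "S.independent (h ` B)"
  proof
    assume "S.dependent (h ` B)"
    then obtain c where c: "\<exists>v\<in>h ` B. c v \<noteq> 0" "(\<Sum>v\<in>h ` B. scale3 (c v) v) = 0"
      using S.dependent_finite[of "h ` B"] B(1) by auto
    then show False using zero[of "c \<circ> h"] by (auto simp: sum.reindex[OF inj])
  qed
  then have "card (h ` B) \<le> card B'"
    using S.independent_span_bound[OF B'(1)] h(1) by blast
  then show ?thesis by (simp add: card_image[OF inj])
qed

lemma quotient_dim_eqI:
  assumes "S.subspace W" "finite B" "basis_mod B V W"
  shows "quotient_dim V W = card B"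
  unfolding quotient_dim_def
  by (rule the_equality) (use assms basis_mod_card_le[OF assms(1)] in \<open>auto intro: antisym\<close>)

lemma global_tjurina_eqI:
  assumes "\<And>k. k \<ge> K \<Longrightarrow> quotient_dim (S_deg k) (jacobian_ideal f) = n"
  shows "global_tjurina f = n"
proof -
  have ev: "\<forall>\<^sub>F k in sequentially. quotient_dim (S_deg k) (jacobian_ideal f) = n"
    using assms eventually_sequentially by blast
  show ?thesis unfolding global_tjurina_def
  proof (rule the_equality)
    show "\<forall>\<^sub>F k in sequentially. quotient_dim (S_deg k) (jacobian_ideal f) = n" by (rule ev)
  next
    fix m assume "\<forall>\<^sub>F k in sequentially. quotient_dim (S_deg k) (jacobian_ideal f) = m"
    with ev have "\<forall>\<^sub>F k in sequentially. m = n" by eventually_elim simp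
    then show "m = n" by simp
  qed
qed

text \<open>Two rectangles of (r-2)(2r-1) exponents overlap in a square of (r-2)^2, and the corner
  adds 1.\<close>

lemma card_normal_exps: "r \<ge> 3 \<Longrightarrow> int (card (normal_exps r)) = 3 * int r ^ 2 - 6 * int r + 1"
proof -
  assume r: "r \<ge> 3"
  then obtain n where n: "r = n + 3" by (metis add.commute le_Suc_ex)
  let ?A = "{..r-3} \<times> {..2*r-2}" and ?B = "{..2*r-2} \<times> {..r-3}"
  have "?A \<inter> ?B = {..r-3} \<times> {..r-3}" using r by auto
  then have "card (?A \<union> ?B) + (n+1) * (n+1) = 2 * ((n+1) * (2*n+5))"
    using card_Un_Int[of ?A ?B] n by (simp add: algebra_simps)
  moreover have "card (normal_exps r) = card (?A \<union> ?B) + 1" unfolding normal_exps_def using r by (subst card_Un_disjoint) auto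
  ultimately have "int (card (normal_exps r)) = 2 * ((int n+1) * (2*int n+5)) + 1 - (int n+1) * (int n+1)"
    by (metis (mono_tags, lifting) add_diff_cancel_right' int_ops(7) of_nat_1 of_nat_add of_nat_mult of_nat_numeral diff_add_eq)
  then show ?thesis by (simp add: n power2_eq_square algebra_simps)
qed

section \<open>A monomial basis of the Milnor algebra in large degree\<close>

definition mon3 :: "nat \<Rightarrow> nat \<Rightarrow> nat \<Rightarrow> poly3" where
  "mon3 i j l = monom (s2 ^ i * t2 ^ j) l"

lemma cf_mon3: "cf (coeff (mon3 i j l) l') i' j' = (if i = i' \<and> j = j' \<and> l = l' then 1 else 0)"
  by (auto simp: mon3_def cf_monom)

text \<open>For r > 3 three moves by \<open>Gs r\<close> suffice from any i, as 3 (r-3) is at least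
  r-1. The last one still needs y-exponent 2r-1, so the first needs 2r-1 + 2(r-3) = 4r-7. For r = 3
  this is the exponent 5 of \<open>Gs 3\<close>.\<close>

lemma monom_in_ideal_xy_tall:
  assumes r: "r \<ge> 3" and j: "4*r-7 \<le> j"
  shows "s2 ^ i * t2 ^ j \<in> ideal_xy r"
proof (cases "r = 3")
  case True
  then show ?thesis using monom_in_ideal_xy_3[of j i] j by simp
next
  case False
  have step: "s2 ^ i * t2 ^ j \<in> ideal_xy r" if "2*r-1 \<le> j" "r-1 \<le> i + (r-3)" for i j
    by (rule monom_in_ideal_xy_Gs[OF r that(1)], rule monom_in_ideal_xy) (use r that in auto)
  have step2: "s2 ^ i * t2 ^ j \<in> ideal_xy r" if "3*r-4 \<le> j" "r-1 \<le> i + 2*(r-3)" for i j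
    by (rule monom_in_ideal_xy_Gs[OF r], (use r that in simp), rule step) (use r that in auto)
  show ?thesis by (rule monom_in_ideal_xy_Gs[OF r], (use r j in simp), rule step2) (use r j False in auto)
qed

text \<open>If i is at least 2r+1, one move by \<open>Fs r\<close> leaves an x-exponent of at least
  r-1. Otherwise j is at least 6r, well above 4r-7; the bound 8r is generous.\<close>

lemma monom_in_ideal_xy_large:
  assumes r: "r \<ge> 3" and ij: "8*r \<le> i + j"
  shows "s2 ^ i * t2 ^ j \<in> ideal_xy r"
proof (cases "2*r+1 \<le> i")
  case True
  show ?thesis
    by (rule monom_in_ideal_xy_Fs[OF r _ ideal_xy_mult[OF monom_in_ideal_xy]]) (use True r in linarith)+
next
  case False
  then have "4*r-7 \<le> j" using ij by linarith
  then show ?thesis by (rule monom_in_ideal_xy_tall[OF r])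
qed

lemma monom_mult_Z: "monom p l = [:p:] * Z ^ l"
proof -
  have "Z ^ l = monom 1 l" by (induction l) (simp_all add: Z_def monom_Suc monom_0 one_pCons smult_monom)
  then show ?thesis by (simp add: smult_monom)
qed

lemma ideal_xy_jacobian:
  assumes r: "r \<ge> 3" and "p \<in> ideal_xy r"
  shows "monom p l \<in> jacobian_ideal (curve r)"
proof -
  let ?J = "jacobian_ideal (curve r)"
  have M: "[:Mxy r:] \<in> ?J"
    using jacobian_ideal_mult[OF jacobian_ideal_gens(3), of "-1" "curve r"] by (simp add: dz_curve)
  have "[:Fs r:] = [:s2:] * dx (curve r) + (of_nat (r-1) * Z) * [:Mxy r:]"
    using s2_Fx[OF r] s2_Px[OF r] by (simp add: dx_curve Z_def of_nat_poly mult.commute)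
  then have F: "[:Fs r:] \<in> ?J" by (metis jacobian_ideal_add jacobian_ideal_gens(1) jacobian_ideal_mult M)
  have "[:Gs r:] = [:t2:] * dy (curve r) + (of_nat (r-1) * Z) * [:Mxy r:]"
    using t2_Fy[OF r] t2_Py[OF r] by (simp add: dy_curve Z_def of_nat_poly mult.commute)
  then have G: "[:Gs r:] \<in> ?J" by (metis jacobian_ideal_add jacobian_ideal_gens(2) jacobian_ideal_mult M)
  obtain a b c where "p = a * Fs r + b * Gs r + c * Mxy r" using assms(2) by (auto simp: ideal_xy_def)
  then have "monom p l = (Z ^ l * [:a:]) * [:Fs r:] + (Z ^ l * [:b:]) * [:Gs r:] + (Z ^ l * [:c:]) * [:Mxy r:]"
    unfolding monom_mult_Z by (simp add: algebra_simps smult_add_left)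
  then show ?thesis using F G M by (metis jacobian_ideal_add jacobian_ideal_mult)
qed

text \<open>The power of z fills the degree up to k, so the number of elements does not depend on k.
  For k at least 8r the truncated difference is exact.\<close>

definition basis_deg :: "nat \<Rightarrow> nat \<Rightarrow> poly3 set" where
  "basis_deg r k = (\<lambda>(i, j). mon3 i j (k - (i + j))) ` normal_exps r"

lemma finite_normal_exps: "finite (normal_exps r)" by (simp add: normal_exps_def)

lemma inj_basis_deg: "inj_on (\<lambda>(i, j). mon3 i j (k - (i + j))) A"
proof (rule inj_onI, clarify)
  fix i j i' j' assume "mon3 i j (k - (i + j)) = mon3 i' j' (k - (i' + j'))"
  from this[THEN arg_cong, of "\<lambda>p. cf (coeff p (k - (i + j))) i j"] show "i = i' \<and> j = j'"
    by (simp add: cf_mon3 split: if_splits)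
qed

lemma cf_scale3: "cf (coeff (scale3 c f) l) i j = c * cf (coeff f l) i j"
  by (simp add: scale3_def const3_def cf_def)

lemma cf_sum: "cf (sum f A) i j = (\<Sum>x\<in>A. cf (f x) i j)"
  by (simp add: cf_def coeff_sum)

lemma basis_deg_independent: "S.independent (basis_deg r k)"
proof
  assume "S.dependent (basis_deg r k)"
  then obtain c v where c: "v \<in> basis_deg r k" "c v \<noteq> 0" "(\<Sum>v\<in>basis_deg r k. scale3 (c v) v) = 0"
    using S.dependent_finite[of "basis_deg r k"] finite_normal_exps[of r] by (auto simp: basis_deg_def)
  then obtain i j where v: "(i, j) \<in> normal_exps r" "v = mon3 i j (k - (i + j))" by (auto simp: basis_deg_def)
  let ?m = "\<lambda>(i, j). mon3 i j (k - (i + j))"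
  have "0 = cf (coeff (\<Sum>v\<in>basis_deg r k. scale3 (c v) v) (k - (i + j))) i j" using c(3) by simp
  also have "\<dots> = (\<Sum>e\<in>normal_exps r. c (?m e) * cf (coeff (?m e) (k - (i + j))) i j)"
    unfolding basis_deg_def by (simp add: sum.reindex[OF inj_basis_deg] coeff_sum cf_sum cf_scale3)
  also have "\<dots> = (\<Sum>e\<in>normal_exps r. if e = (i, j) then c (?m e) else 0)"
    by (rule sum.cong) (auto simp: cf_mon3 split: if_splits)
  also have "\<dots> = c v" using v finite_normal_exps by simp
  finally show False using c(2) by simp
qed

lemma span_basis_deg_supp:
  assumes "u \<in> S.span (basis_deg r k)" "cf (coeff u l) i j \<noteq> 0"
  shows "(i, j) \<in> normal_exps r"
proof -
  let ?U = "{u. \<forall>l i j. cf (coeff u l) i j \<noteq> 0 \<longrightarrow> (i, j) \<in> normal_exps r}"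
  have "S.subspace ?U"
    unfolding S.subspace_def by (auto simp: cf_scale3) (metis add.right_neutral)
  moreover have "basis_deg r k \<subseteq> ?U" by (auto simp: basis_deg_def cf_mon3 split: if_splits)
  ultimately have "u \<in> ?U" using assms(1) S.span_minimal by blast
  then show ?thesis using assms(2) by blast
qed

lemma span_basis_deg_jacobian: "r \<ge> 3 \<Longrightarrow> S.span (basis_deg r k) \<inter> jacobian_ideal (curve r) = {0}"
proof -
  assume r: "r \<ge> 3"
  have "u = 0" if u: "u \<in> S.span (basis_deg r k)" "u \<in> jacobian_ideal (curve r)" for u
  proof -
    obtain a b c where "u = a * dx (curve r) + b * dy (curve r) + c * dz (curve r)"
      using u(2) by (auto simp: jacobian_ideal_def)
    from syzygy_boundary(1)[OF r this span_basis_deg_supp[OF u(1)]] show ?thesis .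
  qed
  then show ?thesis using jacobian_ideal_0 S.span_zero by blast
qed

text \<open>Ascending induction on the power of z. At level 0 every monomial of degree k lies in
  \<open>ideal_xy r\<close>. At level l+1 a monomial is in the basis or in the ideal, or is
  rewritten by \<open>Fs r\<close> or \<open>Gs r\<close>, or has the form x^(r-2) y^j or x^i
  y^(r-2) and is traded through f_x or f_y for monomials of level l.\<close>

lemma basis_deg_spans:
  assumes r: "r \<ge> 3" and k: "8*r \<le> k" and v: "v \<in> S_deg k"
  shows "\<exists>u\<in>S.span (basis_deg r k). v - u \<in> jacobian_ideal (curve r)"
proof -
  let ?J = "jacobian_ideal (curve r)"
  define V where "V = {v. \<exists>u\<in>S.span (basis_deg r k). v - u \<in> ?J}"
  have V_J: "p \<in> V" if "p \<in> ?J" for p using that S.span_zero unfolding V_def by (auto intro!: bexI[of _ 0])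
  have V_add: "p + q \<in> V" if "p \<in> V" "q \<in> V" for p q
  proof -
    obtain a b where "a \<in> S.span (basis_deg r k)" "p - a \<in> ?J" "b \<in> S.span (basis_deg r k)" "q - b \<in> ?J"
      using \<open>p \<in> V\<close> \<open>q \<in> V\<close> by (auto simp: V_def)
    then have "a + b \<in> S.span (basis_deg r k)" "(p + q) - (a + b) \<in> ?J"
      using S.span_add jacobian_ideal_add[of "p - a" _ "q - b"] by (auto simp: algebra_simps)
    then show ?thesis by (auto simp: V_def)
  qed
  have V_scale: "scale3 c p \<in> V" if p: "p \<in> V" for c p
  proof -
    obtain a where a: "a \<in> S.span (basis_deg r k)" "p - a \<in> ?J" using p by (auto simp: V_def)
    then have "scale3 c a \<in> S.span (basis_deg r k)" by (simp add: S.span_scale)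
    moreover have "scale3 c p - scale3 c a \<in> ?J"
      using jacobian_ideal_mult[OF a(2), of "const3 c"] by (simp add: scale3_def right_diff_distrib)
    ultimately show ?thesis by (auto simp: V_def)
  qed
  have V_sum: "sum f A \<in> V" if "\<And>x. x \<in> A \<Longrightarrow> f x \<in> V" for f :: "nat \<Rightarrow> poly3" and A
    using that by (induction A rule: infinite_finite_induct) (auto intro: V_add V_J jacobian_ideal_0)
  \<comment> \<open>\<open>W l\<close> is a linear subspace and not an ideal, because the basis
    lives in the single degree k. Every rewriting step therefore has to preserve the total
    degree.\<close>
  define W where "W l = {p. monom p l \<in> V}" for l
  have scale_monom: "scale3 c (monom p l) = monom (const2 c * p) l" for c p l
    by (simp add: scale3_def const3_def const2_def smult_monom)
  have W_const: "const2 c * p \<in> W l" if "p \<in> W l" for c p l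
    using V_scale[of "monom p l" c] that by (simp add: W_def scale_monom)
  have const_nat: "of_nat n * p = const2 (of_nat n) * p" for n p
    by (rule poly2_eqI) simp
  have W_nat: "of_nat n * p \<in> W l" if "p \<in> W l" for n p l
    using W_const[OF that] by (simp add: const_nat)
  have W_add: "p + q \<in> W l" if "p \<in> W l" "q \<in> W l" for p q l
    using V_add[of "monom p l" "monom q l"] that by (simp add: W_def add_monom)
  have W_diff: "p - q \<in> W l" if "p \<in> W l" "q \<in> W l" for p q l
  proof -
    have "const2 (-1) * q = - q" by (rule poly2_eqI) simp
    then show ?thesis using W_add[OF that(1) W_const[OF that(2), of "-1"]] by simp
  qed
  have W_cancel: "p \<in> W l" if "of_nat n * p \<in> W l" "n > 0" for n p l
  proof -
    have "const2 (1 / of_nat n) * (of_nat n * p) = p" by (rule poly2_eqI) (use that(2) in simp)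
    then show ?thesis using W_const[OF that(1)] by metis
  qed
  have W_H: "p \<in> W l" if "p \<in> ideal_xy r" for p l
    using V_J ideal_xy_jacobian[OF r that] by (simp add: W_def)
  have W_EN: "s2 ^ i * t2 ^ j \<in> W l" if "(i, j) \<in> normal_exps r" "i + j + l = k" for i j l
  proof -
    have "l = k - (i + j)" using that(2) by simp
    then have "mon3 i j l \<in> basis_deg r k" using that(1) by (force simp: basis_deg_def)
    then have "mon3 i j l \<in> S.span (basis_deg r k)" by (rule S.span_base)
    then show ?thesis using jacobian_ideal_0 by (force simp: W_def V_def mon3_def)
  qed
  \<comment> \<open>The Jacobian ideal identifies the two z-coefficients of p f_x, which moves a top
    term one level down.\<close>
  have lower_x: "p * Px r \<in> W (Suc l)" if "p * Fx r \<in> W l" for p l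
  proof -
    have "monom p l * dx (curve r) = monom (p * Fx r) l - monom (p * Px r) (Suc l)"
      by (simp add: dx_curve mult_pCons_right smult_monom monom_Suc minus_monom[symmetric] mult.commute)
    then have "monom (p * Px r) (Suc l) = monom (p * Fx r) l + - monom p l * dx (curve r)"
      by simp
    moreover have "- monom p l * dx (curve r) \<in> V" by (intro V_J jacobian_ideal_mult jacobian_ideal_gens)
    ultimately show ?thesis using that V_add unfolding W_def mem_Collect_eq by metis
  qed
  have lower_y: "p * Py r \<in> W (Suc l)" if "p * Fy r \<in> W l" for p l
  proof -
    have "monom p l * dy (curve r) = monom (p * Fy r) l - monom (p * Py r) (Suc l)"
      by (simp add: dy_curve mult_pCons_right smult_monom monom_Suc minus_monom[symmetric] mult.commute)
    then have "monom (p * Py r) (Suc l) = monom (p * Fy r) l + - monom p l * dy (curve r)"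
      by simp
    moreover have "- monom p l * dy (curve r) \<in> V" by (intro V_J jacobian_ideal_mult jacobian_ideal_gens)
    ultimately show ?thesis using that V_add unfolding W_def mem_Collect_eq by metis
  qed
  have all: "\<forall>i j. i + j + l = k \<longrightarrow> s2 ^ i * t2 ^ j \<in> W l" for l
  proof (induction l)
    case 0
    then show ?case using k by (auto intro!: W_H monom_in_ideal_xy_large r)
  next
    case (Suc l)
    have IH: "s2 ^ i * t2 ^ j \<in> W l" if "i + j + l = k" for i j using Suc that by blast
    \<comment> \<open>Induction on r - i: in the columns i up to r-3 a move by \<open>Gs r\<close>
      raises i by r-3, which is progress for r > 3.\<close>
    have col: "s2 ^ i * t2 ^ j \<in> W (Suc l)" if "i + j + Suc l = k" "r-1 \<le> j" for i j
      using that
    proof (induction "r - i" arbitrary: i j rule: less_induct)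
      case less
      note ij = less.prems
      consider "r-1 \<le> i" | "i = r-2" | "i \<le> r-3" "j \<le> 2*r-2" | "i \<le> r-3" "2*r-1 \<le> j" using r by linarith
      then show ?case
      proof cases
        case 1
        show ?thesis by (rule W_H, rule monom_in_ideal_xy[OF 1 ij(2)])
      next
        case 2
        have "t2 ^ (j-(r-1)) * Fx r \<in> W l"
        proof -
          have e: "t2 ^ (j-(r-1)) * Fx r = of_nat (2*r-1) * (s2 ^ (2*r-2) * t2 ^ (j-(r-1)))
             + of_nat (r-3) * (s2 ^ (r-4) * t2 ^ (j-(r-1)+(r+2)))"
            by (simp only: Fx_def power_add distrib_left) (simp only: mult_ac)
          have "s2 ^ (2*r-2) * t2 ^ (j-(r-1)) \<in> W l" by (rule IH) (use ij 2 r in linarith)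
          moreover have "of_nat (r-3) * (s2 ^ (r-4) * t2 ^ (j-(r-1)+(r+2))) \<in> W l"
          proof (cases "r = 3")
            case True
            then show ?thesis using W_H[OF ideal_xy_mult[OF ideal_xy_gens(1), of 0]] by simp
          next
            case False
            then show ?thesis using ij 2 r by (intro W_nat IH) linarith
          qed
          ultimately show ?thesis unfolding e by (rule W_add[OF W_nat])
        qed
        then have "t2 ^ (j-(r-1)) * Px r \<in> W (Suc l)" by (rule lower_x)
        moreover have "t2 ^ (j-(r-1)) * Px r = of_nat (r-1) * (s2 ^ i * t2 ^ j)"
        proof -
          have "t2 ^ j = t2 ^ (j-(r-1)) * t2 ^ (r-1)" unfolding power_add[symmetric] using ij by simp
          then show ?thesis by (simp only: Px_def 2 mult_ac)
        qed
        ultimately show ?thesis using W_cancel[of "r-1"] r by simp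
      next
        case 3
        then show ?thesis by (intro W_EN[OF _ ij(1)]) (simp add: mem_normal_exps)
      next
        case 4
        show ?thesis
        proof (cases "r = 3")
          case True
          show ?thesis by (rule W_H, subst True, rule monom_in_ideal_xy_3) (use 4 True in simp)
        next
          case False
          have "of_nat (2*r-1) * (s2 ^ i * t2 ^ j) \<in> W (Suc l)"
            unfolding Gs_reduction[OF r 4(2)]
          proof (rule W_diff[OF W_H[OF ideal_xy_mult[OF ideal_xy_gens(2)]] W_nat[OF less.hyps]])
            show "r - (i + (r-3)) < r - i" "i + (r-3) + (j-(r-3)) + Suc l = k" "r-1 \<le> j-(r-3)"
              using 4 ij r False by linarith+
          qed
          then show ?thesis by (rule W_cancel) (use r in simp)
        qed
      qed
    qed
    \<comment> \<open>A move by \<open>Fs r\<close> raises j by r+2 and so lands in the range of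
      \<open>col\<close>.\<close>
    have row: "s2 ^ i * t2 ^ j \<in> W (Suc l)" if ij: "i + j + Suc l = k" "j \<le> r-2" for i j
    proof -
      consider "(i, j) \<in> normal_exps r" | "j = r-2" "r-1 \<le> i" | "j \<le> r-3" "2*r-1 \<le> i"
        using ij r unfolding mem_normal_exps by linarith
      then show ?thesis
      proof cases
        case 1
        then show ?thesis by (rule W_EN[OF _ ij(1)])
      next
        case 2
        have e: "s2 ^ (i-(r-1)) * Fy r = of_nat (2*r-1) * (s2 ^ (i-(r-1)) * t2 ^ (2*r-2))
             + of_nat (r+2) * (s2 ^ (i-(r-1)+(r-3)) * t2 ^ (r+1))"
          by (simp only: Fy_def power_add distrib_left) (simp only: mult_ac)
        have "s2 ^ (i-(r-1)) * Fy r \<in> W l"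
          unfolding e by (intro W_add W_nat IH) (use ij 2 r in linarith)+
        then have "s2 ^ (i-(r-1)) * Py r \<in> W (Suc l)" by (rule lower_y)
        moreover have "s2 ^ (i-(r-1)) * Py r = of_nat (r-1) * (s2 ^ i * t2 ^ j)"
        proof -
          have "s2 ^ i = s2 ^ (i-(r-1)) * s2 ^ (r-1)" unfolding power_add[symmetric] using 2 by simp
          then show ?thesis by (simp only: Py_def 2 mult_ac)
        qed
        ultimately show ?thesis using W_cancel[of "r-1"] r by simp
      next
        case 3
        have "of_nat (2*r-1) * (s2 ^ i * t2 ^ j) \<in> W (Suc l)"
          unfolding Fs_reduction[OF r 3(2)]
        proof (rule W_diff[OF W_H[OF ideal_xy_mult[OF ideal_xy_gens(1)]] W_nat[OF col]])
          show "i - (r+2) + (j + (r+2)) + Suc l = k" "r-1 \<le> j + (r+2)" using 3 ij r by linarith+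
        qed
        then show ?thesis by (rule W_cancel) (use r in simp)
      qed
    qed
    show ?case
    proof (intro allI impI)
      fix i j assume ij: "i + j + Suc l = k"
      have "r-1 \<le> j \<or> j \<le> r-2" by linarith
      then show "s2 ^ i * t2 ^ j \<in> W (Suc l)" using col[OF ij] row[OF ij] by blast
    qed
  qed
  have "v = (\<Sum>l\<le>degree v. monom (coeff v l) l)" by (rule poly_as_sum_of_monoms[symmetric])
  also have "\<dots> \<in> V"
  proof (rule V_sum)
    fix l
    let ?q = "coeff v l"
    have q: "?q = (\<Sum>j\<le>degree ?q. \<Sum>i\<le>degree (coeff ?q j). const2 (cf ?q i j) * (s2 ^ i * t2 ^ j))"
    proof -
      have "const2 c * (s2 ^ i * t2 ^ j) = monom (monom c i) j" for c i j
        by (simp add: s2_t2_monom const2_def smult_monom)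
      moreover have "(\<Sum>i\<le>n. monom (f i) j) = monom (\<Sum>i\<le>n. f i) j" for f :: "nat \<Rightarrow> complex poly" and n j
        by (induction n) (simp_all add: add_monom)
      ultimately show ?thesis by (simp add: cf_def poly_as_sum_of_monoms)
    qed
    have summand: "const2 (cf ?q i j) * (s2 ^ i * t2 ^ j) \<in> W l" for i j
    proof (cases "cf ?q i j = 0")
      case True
      then show ?thesis using W_H[OF ideal_xy_mult[OF ideal_xy_gens(1), of 0]] by (simp add: const2_def)
    next
      case False
      then have "i + j + l = k" using v by (auto simp: S_deg_def homogeneous3_def cf_def)
      then show ?thesis using all by (intro W_const) blast
    qed
    have W_sum: "sum f A \<in> W l" if "\<And>x. x \<in> A \<Longrightarrow> f x \<in> W l" for f :: "nat \<Rightarrow> poly2" and A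
    proof -
      have "0 \<in> W l" by (simp add: W_def V_J[OF jacobian_ideal_0])
      then show ?thesis using that by (induction A rule: infinite_finite_induct) (auto intro: W_add)
    qed
    have "?q \<in> W l" by (subst q) (intro W_sum summand)
    then show "monom ?q l \<in> V" by (simp add: W_def)
  qed
  finally show ?thesis by (simp add: V_def)
qed

lemma global_tjurina_curve:
  assumes r: "r \<ge> 3"
  shows "int (global_tjurina (curve r)) = 3 * int r ^ 2 - 6 * int r + 1"
proof -
  have "quotient_dim (S_deg k) (jacobian_ideal (curve r)) = card (normal_exps r)" if k: "8 * r \<le> k" for k
  proof -
    have "basis_deg r k \<subseteq> S_deg k"
    proof
      fix p assume "p \<in> basis_deg r k"
      then obtain i j where p: "(i, j) \<in> normal_exps r" "p = mon3 i j (k - (i + j))" by (auto simp: basis_deg_def)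
      then have "i + j \<le> k" using normal_exps_bounds[OF p(1) r] k by linarith
      then show "p \<in> S_deg k" unfolding S_deg_def homogeneous3_def mem_Collect_eq p(2)
        using cf_mon3[unfolded cf_def] by auto
    qed
    then have "basis_mod (basis_deg r k) (S_deg k) (jacobian_ideal (curve r))"
      unfolding basis_mod_def
      using basis_deg_independent span_basis_deg_jacobian[OF r] basis_deg_spans[OF r k] by blast
    moreover have "finite (basis_deg r k)" by (simp add: basis_deg_def finite_normal_exps)
    moreover have "card (basis_deg r k) = card (normal_exps r)" by (simp add: basis_deg_def card_image[OF inj_basis_deg])
    ultimately show ?thesis using quotient_dim_eqI[OF jacobian_ideal_subspace] by metis
  qed
  then have "global_tjurina (curve r) = card (normal_exps r)" by (rule global_tjurina_eqI)
  then show ?thesis using card_normal_exps[OF r] by simp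
qed

lemma maximal_tjurina_curve_curve:
  assumes r: "r \<ge> 3"
  shows "maximal_tjurina_curve (2*r-1) r (curve r)"
proof -
  \<comment> \<open>So the binomial coefficient in \<open>tau_max\<close> is 3 choose 2, and
    \<open>tau_max\<close> becomes (2r-2)(r-2) + r^2 - 3.\<close>
  have "2 * r + 2 - (2 * r - 1) = 3" using r by simp
  then have "tau_max (2*r-1) r = 3 * int r ^ 2 - 6 * int r + 1"
    using r by (simp add: tau_max_def of_nat_diff power2_eq_square algebra_simps choose_two)
  then show ?thesis
    unfolding maximal_tjurina_curve_def
    using r reduced_curve_curve[OF r] mdr_curve[OF r] global_tjurina_curve[OF r] by simp
qed

section \<open>Branches at the singular point\<close>

definition fps_cong :: "nat \<Rightarrow> 'a::comm_ring_1 fps \<Rightarrow> 'a fps \<Rightarrow> bool" where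
  "fps_cong N p q \<longleftrightarrow> (\<forall>n<N. p $ n = q $ n)"

lemma fps_cong_refl: "fps_cong N p p" by (simp add: fps_cong_def)

lemma fps_cong_sym: "fps_cong N p q \<Longrightarrow> fps_cong N q p" by (simp add: fps_cong_def)

lemma fps_cong_trans [trans]: "fps_cong N p q \<Longrightarrow> fps_cong N q r \<Longrightarrow> fps_cong N p r" by (simp add: fps_cong_def)

lemma fps_cong_mult: "fps_cong N p q \<Longrightarrow> fps_cong N p' q' \<Longrightarrow> fps_cong N (p * p') (q * q')"
  by (simp add: fps_cong_def fps_mult_nth)

lemma fps_cong_eqI: "(\<And>N. fps_cong N p q) \<Longrightarrow> p = q"
  by (auto simp: fps_cong_def intro!: fps_ext)

lemma power_nth_zero: "(b :: 'a::comm_ring_1 fps) $ 0 = 0 \<Longrightarrow> n < j \<Longrightarrow> b ^ j $ n = 0"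
  using startsby_zero_power_prefix[of b j] by auto

text \<open>Substitution of b for the outer variable. If b has no constant term, b^j has order at
  least j, so coefficient n sees only the summands with j up to n.\<close>

definition eval_fps_at :: "'a::comm_ring_1 fps \<Rightarrow> 'a fps fps \<Rightarrow> 'a fps" where
  "eval_fps_at b k = Abs_fps (\<lambda>n. (\<Sum>j<Suc n. k $ j * b ^ j) $ n)"

lemma eval_fps_at_cong:
  assumes "b $ 0 = 0"
  shows "fps_cong N (eval_fps_at b k) (\<Sum>j<N. k $ j * b ^ j)"
proof -
  have "(k $ j * b ^ j) $ n = 0" if "n < j" for n j
    using power_nth_zero[OF assms] that by (simp add: fps_mult_nth)
  then have "(\<Sum>j<N. k $ j * b ^ j) $ n = (\<Sum>j<Suc n. k $ j * b ^ j) $ n" if "n < N" for n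
    unfolding fps_sum_nth using that by (intro sum.mono_neutral_right) auto
  then show ?thesis by (simp add: fps_cong_def eval_fps_at_def)
qed

lemma unital_hom_eval_fps_at:
  assumes b: "b $ 0 = (0 :: 'a::comm_ring_1)"
  shows "unital_hom (eval_fps_at b)"
  unfolding unital_hom_def
proof (intro conjI allI)
  note cong = eval_fps_at_cong[OF b]
  show "eval_fps_at b 1 = 1"
  proof (rule fps_cong_eqI)
    fix N show "fps_cong N (eval_fps_at b 1) 1"
    proof (cases N)
      case (Suc M)
      have "(\<Sum>j<N. 1 $ j * b ^ j) = (\<Sum>j<N. if j = 0 then 1 else 0)" by (intro sum.cong) auto
      also have "\<dots> = 1" using Suc by simp
      finally show ?thesis using cong[of N 1] by simp
    qed (simp add: fps_cong_def)
  qed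
  fix k k'
  show "eval_fps_at b (k + k') = eval_fps_at b k + eval_fps_at b k'"
    by (rule fps_ext) (simp add: eval_fps_at_def fps_sum_nth distrib_right sum.distrib)
  show "eval_fps_at b (k * k') = eval_fps_at b k * eval_fps_at b k'"
  proof (rule fps_cong_eqI)
    fix N
    \<comment> \<open>Up to order N the square i, j < N can be cut down to the triangle i + j < N,
      and the triangle sums to the Cauchy product.\<close>
    have low: "(k $ i * b ^ i * (k' $ j * b ^ j)) $ n = 0" if "n < N" "N \<le> i + j" for i j n
    proof -
      have "k $ i * b ^ i * (k' $ j * b ^ j) = (k $ i * k' $ j) * b ^ (i + j)" by (simp add: power_add mult_ac)
      then show ?thesis using power_nth_zero[OF b] that by (simp add: fps_mult_nth)
    qed
    let ?T = "\<lambda>(i, j). k $ i * b ^ i * (k' $ j * b ^ j)"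
    have "fps_cong N (eval_fps_at b k * eval_fps_at b k') ((\<Sum>i<N. k $ i * b ^ i) * (\<Sum>j<N. k' $ j * b ^ j))"
      by (intro fps_cong_mult cong)
    also have "(\<Sum>i<N. k $ i * b ^ i) * (\<Sum>j<N. k' $ j * b ^ j) = sum ?T ({..<N} \<times> {..<N})"
      by (simp add: sum_product sum.cartesian_product)
    also have "fps_cong N \<dots> (sum ?T {(i,j). i + j < N})"
      unfolding fps_cong_def fps_sum_nth
      by (intro allI impI sum.mono_neutral_right) (auto intro!: low)
    also have "sum ?T {(i,j). i + j < N} = (\<Sum>n<N. (k * k') $ n * b ^ n)"
    proof -
      have "(\<Sum>i\<le>n. ?T (i, n - i)) = (k * k') $ n * b ^ n" for n
      proof -
        have "?T (i, n - i) = k $ i * k' $ (n - i) * b ^ n" if "i \<le> n" for i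
        proof -
          have "b ^ n = b ^ i * b ^ (n - i)" using that by (simp flip: power_add)
          then show ?thesis by (simp add: mult_ac)
        qed
        then show ?thesis by (simp add: fps_mult_nth[of k] atLeast0AtMost sum_distrib_right)
      qed
      then show ?thesis using sum.triangle_reindex[of "\<lambda>i j. ?T (i, j)" N] by simp
    qed
    finally show "fps_cong N (eval_fps_at b (k * k')) (eval_fps_at b k * eval_fps_at b k')"
      using cong[of N "k * k'"] by (metis fps_cong_sym fps_cong_trans)
  qed
qed

definition compose_coeffs :: "'a::comm_ring_1 fps \<Rightarrow> 'a fps fps \<Rightarrow> 'a fps fps" where
  "compose_coeffs a h = Abs_fps (\<lambda>j. fps_compose (h $ j) a)"

lemma unital_hom_compose_coeffs:
  assumes "(a :: 'a :: idom fps) $ 0 = 0"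
  shows "unital_hom (compose_coeffs a)"
  unfolding unital_hom_def compose_coeffs_def
  by (auto intro!: fps_ext simp: fps_mult_nth fps_compose_add_distrib fps_compose_mult_distrib[OF assms] fps_compose_sum_distrib
      if_distrib[of "\<lambda>x. fps_compose x a"] simp del: fps_compose_nth)

text \<open>The homomorphism C[[u,v]] to C[[s]] with u sent to a and v to b: the pullback along a
  parametrised germ.\<close>

definition param :: "complex fps \<Rightarrow> complex fps \<Rightarrow> fps2 \<Rightarrow> complex fps" where
  "param a b h = eval_fps_at b (compose_coeffs a h)"

lemma unital_hom_comp: "unital_hom f \<Longrightarrow> unital_hom g \<Longrightarrow> unital_hom (\<lambda>x. f (g x))"
  by (simp add: unital_hom_def)

lemma unital_hom_param: "a $ 0 = 0 \<Longrightarrow> b $ 0 = 0 \<Longrightarrow> unital_hom (param a b)"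
  unfolding param_def by (rule unital_hom_comp[OF unital_hom_eval_fps_at unital_hom_compose_coeffs])

lemma param_nth:
  assumes "a $ 0 = 0" "b $ 0 = 0" "n < N"
  shows "param a b h $ n = (\<Sum>j<N. \<Sum>i<N. h $ j $ i * (a ^ i * b ^ j) $ n)"
proof -
  have "param a b h $ n = (\<Sum>j<N. fps_compose (h $ j) a * b ^ j) $ n"
    using eval_fps_at_cong[OF assms(2), of N "compose_coeffs a h"] assms(3)
    by (simp add: fps_cong_def param_def compose_coeffs_def)
  also have "\<dots> = (\<Sum>j<N. \<Sum>i<N. h $ j $ i * (a ^ i * b ^ j) $ n)"
    unfolding fps_sum_nth
  proof (rule sum.cong[OF refl])
    fix j
    have "fps_cong N (fps_compose (h $ j) a) (\<Sum>i<N. fps_const (h $ j $ i) * a ^ i)"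
      unfolding fps_cong_def
    proof (intro allI impI)
      fix m assume "m < N"
      have "(\<Sum>i<N. fps_const (h $ j $ i) * a ^ i) $ m = (\<Sum>i<N. h $ j $ i * a ^ i $ m)"
        by (simp add: fps_sum_nth)
      also have "\<dots> = (\<Sum>i=0..m. h $ j $ i * a ^ i $ m)"
        using \<open>m < N\<close> power_nth_zero[OF assms(1)] by (intro sum.mono_neutral_right) auto
      finally show "fps_compose (h $ j) a $ m = (\<Sum>i<N. fps_const (h $ j $ i) * a ^ i) $ m"
        by (simp add: fps_compose_nth)
    qed
    then have "fps_cong N (fps_compose (h $ j) a * b ^ j) ((\<Sum>i<N. fps_const (h $ j $ i) * a ^ i) * b ^ j)"
      by (intro fps_cong_mult fps_cong_refl)
    then have "(fps_compose (h $ j) a * b ^ j) $ n = ((\<Sum>i<N. fps_const (h $ j $ i) * a ^ i) * b ^ j) $ n"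
      using assms(3) by (simp add: fps_cong_def)
    then show "(fps_compose (h $ j) a * b ^ j) $ n = (\<Sum>i<N. h $ j $ i * (a ^ i * b ^ j) $ n)"
      by (simp add: sum_distrib_right fps_sum_nth mult.assoc)
  qed
  finally show ?thesis .
qed

text \<open>Each application gains one order in u, so iterating from 0 settles the coefficient of
  u^i after i+1 rounds, uniformly in the power of v.\<close>

lemma fixpoint_fps2:
  fixes \<Phi> :: "fps2 \<Rightarrow> fps2"
  assumes contr: "\<And>q q' n. (\<And>j i. i < n \<Longrightarrow> q $ j $ i = q' $ j $ i) \<Longrightarrow> (\<And>j i. i \<le> n \<Longrightarrow> \<Phi> q $ j $ i = \<Phi> q' $ j $ i)"
  shows "\<exists>q. \<Phi> q = q"
proof -
  define Q where "Q n = (\<Phi> ^^ n) 0" for n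
  have QS: "Q (Suc n) = \<Phi> (Q n)" for n by (simp add: Q_def)
  have step: "i < n \<Longrightarrow> Q (Suc n) $ j $ i = Q n $ j $ i" for n i j
  proof (induction n arbitrary: i j)
    case (Suc n)
    show ?case unfolding QS[of "Suc n"] unfolding QS[of n]
      by (rule contr[of n]) (use Suc in \<open>auto simp: QS\<close>)
  qed simp
  have stable: "Q m $ j $ i = Q n $ j $ i" if "i < n" "n \<le> m" for n m i j
    using that(2) by (induction rule: dec_induct) (use that(1) in \<open>auto simp: step\<close>)
  define q where "q = Abs_fps (\<lambda>j. Abs_fps (\<lambda>i. Q (Suc i) $ j $ i))"
  have q: "i < n \<Longrightarrow> q $ j $ i = Q n $ j $ i" for i j n
    using stable[of i "Suc i" n j] by (simp add: q_def)
  have "\<Phi> q = q"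
  proof (intro fps_ext)
    fix j i
    have "\<Phi> q $ j $ i = \<Phi> (Q i) $ j $ i" by (rule contr[of i]) (auto simp: q)
    also have "\<dots> = q $ j $ i" using q[of i "Suc i" j] by (simp add: QS)
    finally show "\<Phi> q $ j $ i = q $ j $ i" .
  qed
  then show ?thesis ..
qed

text \<open>The quotient is a fixed point of \<open>q \<mapsto> shift (h + q C)\<close>, which is contracting in the u-adic sense.\<close>

lemma weierstrass_division:
  fixes h C :: fps2
  assumes C: "\<And>j. C $ j $ 0 = 0"
  shows "\<exists>q. \<forall>j\<ge>m. (h - q * (fps_X ^ m - C)) $ j = 0"
proof -
  define \<Phi> where "\<Phi> q = fps_shift m h + fps_shift m (q * C)" for q
  have "\<exists>q. \<Phi> q = q"
  proof (rule fixpoint_fps2)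
    fix q q' :: fps2 and n j i
    assume eq: "\<And>j i. i < n \<Longrightarrow> q $ j $ i = q' $ j $ i" and i: "i \<le> n"
    have "(q $ j' * C $ j'') $ i = (q' $ j' * C $ j'') $ i" for j' j''
      unfolding fps_mult_nth
    proof (rule sum.cong[OF refl])
      fix i' assume "i' \<in> {0..i}"
      then show "q $ j' $ i' * C $ j'' $ (i - i') = q' $ j' $ i' * C $ j'' $ (i - i')"
        using eq[of i' j'] i C by (cases "i' = i") auto
    qed
    then show "\<Phi> q $ j $ i = \<Phi> q' $ j $ i"
      by (simp add: \<Phi>_def fps_mult_nth[of _ C] fps_sum_nth)
  qed
  then obtain q where q: "\<Phi> q = q" ..
  have "(h - q * (fps_X ^ m - C)) $ j = 0" if "m \<le> j" for j
  proof -
    have "q $ (j - m) = h $ j + (q * C) $ j" using q that unfolding \<Phi>_def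
      by (metis fps_add_nth fps_shift_nth le_add_diff_inverse2)
    moreover have "(h - q * (fps_X ^ m - C)) $ j = h $ j + (q * C) $ j - (q * fps_X ^ m) $ j"
      by (simp add: right_diff_distrib)
    ultimately show ?thesis using that by (simp add: fps_X_power_mult_right_nth)
  qed
  then show ?thesis by blast
qed

text \<open>From N0 on \<open>E N\<close> has order exactly N, so the coefficients of w can be
  eliminated one after another. Each c n depends on all earlier ones, hence the well-founded
  recursion. Below N0 both w and c vanish, so orders may be missing there.\<close>

lemma triangular_expansion:
  fixes E :: "nat \<Rightarrow> 'a::field fps"
  assumes E: "\<And>N n. n < N \<Longrightarrow> E N $ n = 0" "\<And>N. N \<ge> N0 \<Longrightarrow> E N $ N \<noteq> 0"
    and w: "\<And>n. n < N0 \<Longrightarrow> w $ n = 0"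
  shows "\<exists>c. (\<forall>n<N0. c n = 0) \<and> (\<forall>n. w $ n = (\<Sum>N\<le>n. c N * E N $ n))"
proof -
  have "\<exists>c. \<forall>n. c n = (if n < N0 then 0 else (w $ n - (\<Sum>N<n. c N * E N $ n)) / E n $ n)"
  proof -
    define F where "F c n = (if n < N0 then 0 else (w $ n - (\<Sum>N<n. c N * E N $ n)) / E n $ n)" for c :: "nat \<Rightarrow> 'a" and n
    have "adm_wf less_than F"
      unfolding adm_wf_def F_def by (auto intro!: arg_cong2[where f = "(/)"] arg_cong2[where f = "(-)"] sum.cong)
    from wfrec_fixpoint[OF wf_less_than this] have "wfrec less_than F n = F (wfrec less_than F) n" for n by metis
    then show ?thesis unfolding F_def by blast
  qed
  then obtain c where c: "\<And>n. c n = (if n < N0 then 0 else (w $ n - (\<Sum>N<n. c N * E N $ n)) / E n $ n)" by blast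
  have "w $ n = (\<Sum>N\<le>n. c N * E N $ n)" for n
  proof (cases "n < N0")
    case True
    then have "c N = 0" if "N \<le> n" for N using c[of N] that by simp
    then show ?thesis using w[OF True] by simp
  next
    case False
    then have "c n * E n $ n = w $ n - (\<Sum>N<n. c N * E N $ n)" using c[of n] E(2)[of n] by simp
    then show ?thesis by (simp add: lessThan_Suc_atMost[symmetric])
  qed
  moreover have "\<forall>n<N0. c n = 0" using c by simp
  ultimately show ?thesis by blast
qed

text \<open>n is invertible modulo m, which determines j in the range j < m.\<close>

lemma coprime_combination_unique:
  fixes m n :: nat
  assumes "coprime m n" "j < m" "j' < m" "i * m + j * n = i' * m + j' * n"
  shows "i = i' \<and> j = j'"
proof -
  have "int i * int m + int j * int n = int i' * int m + int j' * int n"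
    using assms(4) by (metis of_nat_add of_nat_mult)
  then have "(int j - int j') * int n = (int i' - int i) * int m" by (simp add: algebra_simps)
  then have "int m dvd (int j - int j') * int n" by simp
  then have dvd: "int m dvd int j - int j'"
    using assms(1) by (simp add: coprime_dvd_mult_left_iff)
  have "int j - int j' = 0"
  proof (rule ccontr)
    assume "int j - int j' \<noteq> 0"
    then have "int m \<le> \<bar>int j - int j'\<bar>" using dvd_imp_le_int[OF _ dvd] by simp
    then show False using assms(2,3) by simp
  qed
  then have "j = j'" by simp
  then show ?thesis using assms by auto
qed

text \<open>Multiplication by n permutes the residues modulo m, so some j < m has the right residue,
  and N is large enough for N - j n to be nonnegative.\<close>

lemma coprime_combination_exists:
  fixes m n N :: nat
  assumes "coprime m n" "m > 0" "m * n \<le> N"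
  shows "\<exists>i j. j < m \<and> i * m + j * n = N"
proof -
  have "inj_on (\<lambda>j. j * n mod m) {..<m}"
  proof (rule inj_onI)
    fix j j' assume j: "j \<in> {..<m}" "j' \<in> {..<m}" "j * n mod m = j' * n mod m"
    \<comment> \<open>The quotients turn the congruence into an equation to which uniqueness
      applies.\<close>
    define A B where "A = j * n div m" and "B = j' * n div m"
    have "j * n = A * m + j * n mod m" "j' * n = B * m + j' * n mod m" by (simp_all add: A_def B_def)
    then have "B * m + j * n = A * m + j' * n" using j(3) by simp
    then show "j = j'" using coprime_combination_unique[OF assms(1)] j(1,2) by blast
  qed
  moreover have "(\<lambda>j. j * n mod m) ` {..<m} \<subseteq> {..<m}" using assms(2) by auto
  ultimately have "(\<lambda>j. j * n mod m) ` {..<m} = {..<m}" by (intro endo_inj_surj) auto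
  then obtain j where j: "j < m" "j * n mod m = N mod m"
    using assms(2) by (metis (no_types, lifting) imageE lessThan_iff mod_less_divisor)
  have "j * n \<le> N" using j(1) assms(3) by (meson le_trans less_imp_le mult_le_mono1)
  moreover have "m dvd N - j * n" using j(2) calculation by (metis mod_eq_dvd_iff_nat)
  ultimately obtain i where "N - j * n = m * i" by (elim dvdE)
  then have "i * m + j * n = N" using \<open>j * n \<le> N\<close> by (simp add: mult.commute)
  then show ?thesis using j(1) by blast
qed

section \<open>The kernel of a parametrisation\<close>

lemma param_v: "a $ 0 = 0 \<Longrightarrow> b $ 0 = 0 \<Longrightarrow> param a b v_loc = b"
  and param_u: "a $ 0 = 0 \<Longrightarrow> b $ 0 = 0 \<Longrightarrow> param a b u_loc = a"
proof -
  assume ab: "a $ 0 = 0" "b $ 0 = 0"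
  have const: "eval_fps_at b (fps_const x) = x" for x
  proof (rule fps_ext)
    fix n
    have "(\<Sum>j<Suc n. fps_const x $ j * b ^ j) = (\<Sum>j<Suc n. if j = 0 then x else 0)"
      by (rule sum.cong) auto
    then show "eval_fps_at b (fps_const x) $ n = x $ n" by (simp add: eval_fps_at_def del: sum.lessThan_Suc)
  qed
  have "compose_coeffs a (fps_const x) = fps_const (fps_compose x a)" for x
    by (rule fps_ext) (simp add: compose_coeffs_def)
  then show "param a b u_loc = a"
    using ab by (simp add: param_def const u_loc_def)
  have X: "compose_coeffs a fps_X = fps_X"
    by (rule fps_ext) (simp add: compose_coeffs_def fps_X_def)
  show "param a b v_loc = b"
  proof (rule fps_ext)
    fix n
    have "(\<Sum>j<n+2. fps_X $ j * b ^ j) = (\<Sum>j<n+2. if j = 1 then b else 0)"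
      by (rule sum.cong) (auto simp: fps_X_def)
    also have "\<dots> = b" by simp
    finally show "param a b v_loc $ n = b $ n"
      using eval_fps_at_cong[OF ab(2), of "n+2" fps_X] by (simp add: param_def v_loc_def X fps_cong_def)
  qed
qed

text \<open>Restriction to the line u = 0. The order of the result is additive on products; it tells
  the two primes apart and detects the unit factor.\<close>

definition at_u0 :: "fps2 \<Rightarrow> complex fps" where
  "at_u0 h = Abs_fps (\<lambda>j. h $ j $ 0)"

lemma unital_hom_at_u0: "unital_hom at_u0"
  unfolding unital_hom_def
proof (intro conjI allI)
  show "at_u0 1 = 1" by (rule fps_ext) (simp add: at_u0_def)
  show "at_u0 (h + k) = at_u0 h + at_u0 k" for h k by (rule fps_ext) (simp add: at_u0_def)
  show "at_u0 (h * k) = at_u0 h * at_u0 k" for h k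
    by (rule fps_ext) (simp add: at_u0_def fps_mult_nth[of h] fps_mult_nth[of "at_u0 h", unfolded at_u0_def] fps_sum_nth)
qed

text \<open>By coprimality the orders \<open>i m + j n\<close> of \<open>a^i b^j\<close> with \<open>j < m\<close> are pairwise distinct and exhaust all
  \<open>N \<ge> m n\<close>. Hence \<open>b^m\<close> is a combination of lower powers of b over \<open>C[[a]]\<close>, and remainders of degree
  below m in v are not killed.\<close>

lemma kernel_param:
  assumes mn: "subdegree a = m" "subdegree b = n" "m > 0" "n > 0" "coprime m n"
  shows "\<exists>P. prime_elem P \<and> (\<forall>h. param a b h = 0 \<longleftrightarrow> P dvd h) \<and> at_u0 P = fps_X ^ m"
proof -
  have nz: "a \<noteq> 0" "b \<noteq> 0" using mn by auto
  have ab0: "a $ 0 = 0" "b $ 0 = 0" using mn by (auto intro: nth_less_subdegree_zero)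
  note hom = unital_hom_simps[OF unital_hom_param[OF ab0]]
  have sub: "subdegree (a ^ i * b ^ j) = i * m + j * n" for i j
    using nz mn by (simp add: subdegree_power)
  have ab_less: "(a ^ i * b ^ j) $ k = 0" if "k < i * m + j * n" for i j k
    using that by (intro nth_less_subdegree_zero) (simp add: sub)
  have ab_eq: "(a ^ i * b ^ j) $ (i * m + j * n) \<noteq> 0" for i j
    using nth_subdegree_nonzero[of "a ^ i * b ^ j"] nz by (simp add: sub)
  have "\<forall>N. \<exists>i j. m * n \<le> N \<longrightarrow> j < m \<and> i * m + j * n = N"
    using coprime_combination_exists[OF mn(5,3)] by blast
  then obtain I J where IJ: "\<And>N. m * n \<le> N \<Longrightarrow> J N < m" "\<And>N. m * n \<le> N \<Longrightarrow> I N * m + J N * n = N"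
    by metis
  have bound: "i \<le> i * m + j * n" "j \<le> i * m + j * n" for i j
  proof -
    have "i * 1 \<le> i * m" "j * 1 \<le> j * n" by (rule mult_le_mono2, use mn in linarith)+
    then show "i \<le> i * m + j * n" "j \<le> i * m + j * n" by linarith+
  qed
  define E where "E N = (if m * n \<le> N then a ^ I N * b ^ J N else 0)" for N
  have "\<exists>c. (\<forall>k<m*n. c k = 0) \<and> (\<forall>k. b ^ m $ k = (\<Sum>N\<le>k. c N * E N $ k))"
  proof (rule triangular_expansion)
    show "E N $ k = 0" if "k < N" for N k
      using ab_less[of k "I N" "J N"] IJ(2)[of N] that by (simp add: E_def)
    show "E N $ N \<noteq> 0" if "m * n \<le> N" for N
      using ab_eq[of "I N" "J N"] IJ(2)[of N] that by (simp add: E_def)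
    show "b ^ m $ k = 0" if "k < m * n" for k
      using ab_less[of k 0 m] that by simp
  qed
  then obtain c where c: "\<And>k. k < m * n \<Longrightarrow> c k = 0" "\<And>k. b ^ m $ k = (\<Sum>N\<le>k. c N * E N $ k)" by blast
  \<comment> \<open>The expansion of b^m regrouped by N = i m + j n into a polynomial of degree
    below m in v.\<close>
  define C :: fps2 where "C = Abs_fps (\<lambda>j. if j < m then Abs_fps (\<lambda>i. c (i * m + j * n)) else 0)"
  \<comment> \<open>j n < m n lies where c vanishes. Thus u divides \<open>C\<close>, as Weierstrass
    division requires.\<close>
  have C0: "C $ j $ 0 = 0" for j using mn c(1) by (simp add: C_def)
  define P where "P = fps_X ^ m - C"
  have "param a b C = b ^ m"
  proof (rule fps_ext)
    fix k
    \<comment> \<open>Off this set a term vanishes, since c is 0, or j is at least m, or a^i b^j has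
      order above k. On it the pairs correspond bijectively to the N between m n and k.\<close>
    let ?S = "{(j, i). j \<le> k \<and> i \<le> k \<and> j < m \<and> m * n \<le> i * m + j * n \<and> i * m + j * n \<le> k}"
    let ?t = "\<lambda>(j, i). C $ j $ i * (a ^ i * b ^ j) $ k"
    have "param a b C $ k = (\<Sum>j<Suc k. \<Sum>i<Suc k. C $ j $ i * (a ^ i * b ^ j) $ k)"
      by (rule param_nth[OF ab0]) simp
    also have "\<dots> = sum ?t ({..<Suc k} \<times> {..<Suc k})" by (simp only: sum.cartesian_product)
    also have "\<dots> = sum ?t ?S"
    proof (rule sum.mono_neutral_right)
      show "\<forall>x\<in>{..<Suc k} \<times> {..<Suc k} - ?S. ?t x = 0"
      proof
        fix x assume x: "x \<in> {..<Suc k} \<times> {..<Suc k} - ?S"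
        obtain j i where ji: "x = (j, i)" by (cases x)
        show "?t x = 0"
        proof (cases "i * m + j * n \<le> k \<and> j < m")
          case True
          then have "i * m + j * n < m * n" using x by (auto simp: ji)
          then show ?thesis using True c(1) by (simp add: ji C_def)
        next
          case False
          then show ?thesis using ab_less[of k i j] by (auto simp: ji C_def)
        qed
      qed
    qed auto
    also have "\<dots> = (\<Sum>N\<in>{m*n..k}. c N * (a ^ I N * b ^ J N) $ k)"
    proof (rule sum.reindex_bij_witness[where i = "\<lambda>N. (J N, I N)" and j = "\<lambda>(j, i). i * m + j * n"])
      fix x assume x: "x \<in> ?S"
      obtain j i where ji: "x = (j, i)" by (cases x)
      have N: "m * n \<le> i * m + j * n" "j < m" using x ji by auto
      have "I (i * m + j * n) = i \<and> J (i * m + j * n) = j"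
        using coprime_combination_unique[OF mn(5) IJ(1)[OF N(1)] N(2) IJ(2)[OF N(1)]] .
      then show "(J ((\<lambda>(j, i). i * m + j * n) x), I ((\<lambda>(j, i). i * m + j * n) x)) = x"
        "c ((\<lambda>(j, i). i * m + j * n) x) * (a ^ I ((\<lambda>(j, i). i * m + j * n) x) * b ^ J ((\<lambda>(j, i). i * m + j * n) x)) $ k = ?t x"
        using N by (simp_all add: ji C_def)
      show "(\<lambda>(j, i). i * m + j * n) x \<in> {m * n..k}" using x by auto
    next
      fix N assume N: "N \<in> {m*n..k}"
      then show "(\<lambda>(j, i). i * m + j * n) (J N, I N) = N" using IJ(2) by simp
      have "I N \<le> N" "J N \<le> N" using IJ(2)[of N] N bound(1)[of "I N" "J N"] bound(2)[of "J N" "I N"] by auto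
      then show "(J N, I N) \<in> ?S" using IJ[of N] N by auto
    qed
    also have "\<dots> = (\<Sum>N\<in>{m*n..k}. c N * E N $ k)"
      by (rule sum.cong) (auto simp: E_def)
    also have "\<dots> = (\<Sum>N\<le>k. c N * E N $ k)"
      by (rule sum.mono_neutral_left) (auto simp: E_def)
    finally show "param a b C $ k = b ^ m $ k" by (simp add: c(2))
  qed
  moreover have "param a b fps_X = b" using param_v[OF ab0] by (simp add: v_loc_def)
  ultimately have P0: "param a b P = 0" by (simp add: P_def hom)
  have ker: "P dvd h" if h: "param a b h = 0" for h
  proof -
    obtain q where q: "\<forall>j\<ge>m. (h - q * P) $ j = 0" using weierstrass_division[OF C0] unfolding P_def by blast
    define R where "R = h - q * P"
    have R0: "param a b R = 0" by (simp add: R_def hom h P0)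
    have "R = 0"
    proof (rule ccontr)
      assume "R \<noteq> 0"
      then obtain j i where "R $ j $ i \<noteq> 0" by (metis fps_ext fps_zero_nth)
      then have ex: "\<exists>K i j. R $ j $ i \<noteq> 0 \<and> i * m + j * n = K" by blast
      \<comment> \<open>The least order of a^i b^j among the terms of the remainder. Its degree in v
        is below m, so exactly one term attains this order and cannot cancel in the image.\<close>
      define K where "K = (LEAST K. \<exists>i j. R $ j $ i \<noteq> 0 \<and> i * m + j * n = K)"
      have min: "K \<le> i * m + j * n" if "R $ j $ i \<noteq> 0" for i j
        unfolding K_def by (rule Least_le) (use that in blast)
      have "\<exists>i j. R $ j $ i \<noteq> 0 \<and> i * m + j * n = K" unfolding K_def by (rule LeastI_ex[OF ex])
      then obtain i j where ij: "R $ j $ i \<noteq> 0" "i * m + j * n = K" by blast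
      have small: "j' < m" if "R $ j' $ i' \<noteq> 0" for i' j' using q that by (metis R_def fps_zero_nth not_le)
      have le: "i \<le> K" "j \<le> K" using bound(1)[of i j] bound(2)[of j i] ij(2) by simp_all
      have "param a b R $ K = (\<Sum>j'<Suc K. \<Sum>i'<Suc K. R $ j' $ i' * (a ^ i' * b ^ j') $ K)"
        by (rule param_nth[OF ab0]) simp
      also have "\<dots> = (\<Sum>j'<Suc K. \<Sum>i'<Suc K. if j' = j then if i' = i then R $ j $ i * (a ^ i * b ^ j) $ K else 0 else 0)"
      proof (intro sum.cong refl)
        fix i' j'
        have "R $ j' $ i' * (a ^ i' * b ^ j') $ K = 0" if ne: "(i', j') \<noteq> (i, j)"
        proof (rule ccontr)
          assume "R $ j' $ i' * (a ^ i' * b ^ j') $ K \<noteq> 0"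
          then have R: "R $ j' $ i' \<noteq> 0" and "(a ^ i' * b ^ j') $ K \<noteq> 0" by auto
          then have "i' * m + j' * n \<le> K" using ab_less[of K i' j'] by linarith
          then have "i' * m + j' * n = i * m + j * n" using min[OF R] ij(2) by simp
          then show False using coprime_combination_unique[OF mn(5) small[OF R] small[OF ij(1)]] ne by blast
        qed
        then show "R $ j' $ i' * (a ^ i' * b ^ j') $ K = (if j' = j then if i' = i then R $ j $ i * (a ^ i * b ^ j) $ K else 0 else 0)"
          by auto
      qed
      also have "\<dots> = R $ j $ i * (a ^ i * b ^ j) $ K"
      proof -
        have "(\<Sum>i'<Suc K. if j' = j then if i' = i then x else 0 else 0) = (if j' = j then x else 0)"
          for j' and x :: complex using le by (simp del: sum.lessThan_Suc)
        then show ?thesis using le by (simp del: sum.lessThan_Suc)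
      qed
      also have "\<dots> \<noteq> 0" using ij ab_eq[of i j] by simp
      finally show False using R0 by simp
    qed
    then show ?thesis by (simp add: R_def)
  qed
  have iff: "param a b h = 0 \<longleftrightarrow> P dvd h" for h
    using ker P0 by (auto simp: hom elim!: dvdE)
  have u0: "at_u0 P = fps_X ^ m"
    by (rule fps_ext) (simp add: at_u0_def P_def C0 fps_X_power_nth)
  have "P \<noteq> 0" using u0 by (auto simp: unital_hom_simps[OF unital_hom_at_u0])
  \<comment> \<open>The target C[[s]] is a domain, so the kernel is a prime ideal.\<close>
  then have "prime_elem P"
    unfolding prime_elem_def iff[symmetric] by (auto simp: hom)
  then show ?thesis using iff u0 by blast
qed

section \<open>Prime factors of the local equation\<close>

lemma prime_elem_irreducible:
  fixes p :: "'a :: idom"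
  assumes "prime_elem p"
  shows "irreducible p"
proof (rule irreducibleI)
  fix a b assume p: "p = a * b"
  then have "p dvd a \<or> p dvd b" using assms prime_elem_dvd_multD[of p a b] by simp
  then show "a dvd 1 \<or> b dvd 1"
  proof
    assume "p dvd a"
    then obtain c where "a = p * c" by (elim dvdE)
    then have "a = a * b * c" using p by metis
    then have "a * (b * c) = a * 1" by (metis mult.assoc mult_1_right)
    moreover have "a \<noteq> 0" using assms p by auto
    ultimately have "b * c = 1" using mult_cancel_left by blast
    then show ?thesis by (metis dvdI)
  next
    assume "p dvd b"
    then obtain c where "b = p * c" by (elim dvdE)
    then have "b = a * b * c" using p by metis
    then have "b * (a * c) = b * 1" by (metis mult.assoc mult.commute mult_1_right)
    moreover have "b \<noteq> 0" using assms p by auto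
    ultimately have "a * c = 1" using mult_cancel_left by blast
    then show ?thesis by (metis dvdI)
  qed
qed (use assms in \<open>auto simp: prime_elem_def\<close>)

text \<open>If neither prime divides p, both can be cancelled from P1 P2 w = p q, which makes p a
  divisor of the unit w. A prime dividing the irreducible p is associated to it.\<close>

lemma irreducible_divisor_of_primes:
  fixes P1 P2 :: "'a :: idom"
  assumes "prime_elem P1" "prime_elem P2" "w dvd 1" "irreducible p" "p dvd P1 * P2 * w"
  shows "p dvd P1 \<and> P1 dvd p \<or> p dvd P2 \<and> P2 dvd p"
proof -
  have assoc: "p dvd P \<and> P dvd p" if "prime_elem P" "P dvd p" for P
  proof -
    obtain k where k: "p = P * k" using \<open>P dvd p\<close> by (elim dvdE)
    have "\<not> P dvd 1" using that(1) by (simp add: prime_elem_def)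
    then have "k dvd 1" using irreducibleD[OF assms(4) k] by blast
    then obtain k' where "1 = k * k'" by (elim dvdE)
    then have "P = p * k'" using k by (simp add: mult.assoc)
    then show ?thesis using that(2) by (metis dvdI)
  qed
  obtain q where q: "P1 * P2 * w = p * q" using assms(5) by (elim dvdE)
  show ?thesis
  proof (cases "P1 dvd p")
    case True then show ?thesis using assoc[OF assms(1)] by blast
  next
    case False
    have "P1 dvd p * q" unfolding q[symmetric] by (simp add: mult.assoc)
    then have "P1 dvd q" using False assms(1) prime_elem_dvd_multD by blast
    then obtain q' where "q = P1 * q'" by (elim dvdE)
    then have "P1 * (P2 * w) = P1 * (p * q')" using q by (simp add: mult_ac)
    moreover have "P1 \<noteq> 0" using assms(1) by auto
    ultimately have q': "P2 * w = p * q'" using mult_cancel_left by blast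
    show ?thesis
    proof (cases "P2 dvd p")
      case True then show ?thesis using assoc[OF assms(2)] by blast
    next
      case False
      have "P2 dvd p * q'" unfolding q'[symmetric] by simp
      then have "P2 dvd q'" using False assms(2) prime_elem_dvd_multD by blast
      then obtain q'' where "q' = P2 * q''" by (elim dvdE)
      then have "P2 * w = P2 * (p * q'')" using q' by (simp add: mult_ac)
      moreover have "P2 \<noteq> 0" using assms(2) by auto
      ultimately have "w = p * q''" using mult_cancel_left by blast
      then have "p dvd 1" using assms(3) by (metis dvd_trans dvd_triv_left)
      then show ?thesis using assms(4) by (simp add: irreducible_def)
    qed
  qed
qed

lemma unit_fps2: "w $ 0 $ 0 \<noteq> 0 \<Longrightarrow> w dvd 1" for w :: fps2
proof -
  assume "w $ 0 $ 0 \<noteq> 0"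
  then have "w $ 0 * inverse (w $ 0) = 1" by (simp add: inverse_mult_eq_1')
  then have "w * fps_right_inverse w (inverse (w $ 0)) = 1" by (rule fps_right_inverse)
  then show ?thesis by (metis dvdI)
qed

text \<open>The point c (x, y) lies on the affine curve if c^(2r-1) \<open>form r x y\<close> =
  c^(2r-2) (x y)^(r-1); cancelling c^(2r-2) gives this c, with e the inverse of the form.\<close>

lemma form_param:
  assumes r: "r \<ge> 3" and xy: "x * y = (z :: 'a :: comm_ring_1)" and e: "form r x y * e = 1"
  defines "c \<equiv> z ^ (r-1) * e"
  shows "form r (c * x) (c * y) = (c * x) ^ (r-1) * (c * y) ^ (r-1)"
proof -
  have "c ^ (2*r-1) = c ^ (r-1) * c ^ (r-1) * c"
    using r by (simp only: power_add[symmetric] power_Suc2[symmetric]) (rule arg_cong[where f = "power c"], simp)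
  then have "form r (c * x) (c * y) = c ^ (r-1) * c ^ (r-1) * (c * form r x y)"
    unfolding form_mult[OF r] by (simp only: mult.assoc)
  also have "c * form r x y = z ^ (r-1) * (form r x y * e)" unfolding c_def by (simp only: mult_ac)
  also have "\<dots> = x ^ (r-1) * y ^ (r-1)" by (simp only: e mult_1_right xy[symmetric] power_mult_distrib)
  finally show ?thesis by (simp only: power_mult_distrib mult_ac)
qed

lemma card_branches_curve:
  assumes r: "r \<ge> 3"
  shows "card (branches (curve r) 0 0 1) = 2"
proof -
  define g where "g = local_eq (curve r) 0 0 1"
  have g: "g = form r u_loc v_loc - u_loc ^ (r-1) * v_loc ^ (r-1)"
  proof -
    have "const_loc 0 = 0" by (simp add: const_loc_def)
    then show ?thesis
      by (simp add: g_def local_eq_def curve_eq_XYZ form_def eval3_simps[OF unital_hom_const_loc])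
  qed
  \<comment> \<open>The directions (s, 1) and (1, s) approach the two lines u = 0 and v = 0 of the
    tangent cone u^(r-1) v^(r-1).\<close>
  define D1 where "D1 = form r (fps_X :: complex fps) 1"
  define D2 where "D2 = form r 1 (fps_X :: complex fps)"
  have D0: "D1 $ 0 \<noteq> 0" "D2 $ 0 \<noteq> 0"
    using r by (auto simp: D1_def D2_def form_def fps_power_zeroth power_0_left)
  define c1 where "c1 = fps_X ^ (r-1) * inverse D1"
  define c2 where "c2 = fps_X ^ (r-1) * inverse D2"
  have par1: "form r (c1 * fps_X) (c1 * 1) = (c1 * fps_X) ^ (r-1) * (c1 * 1) ^ (r-1)"
    unfolding c1_def by (rule form_param[OF r]) (use D0 in \<open>simp_all add: inverse_mult_eq_1' flip: D1_def\<close>)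
  have par2: "form r (c2 * 1) (c2 * fps_X) = (c2 * 1) ^ (r-1) * (c2 * fps_X) ^ (r-1)"
    unfolding c2_def by (rule form_param[OF r]) (use D0 in \<open>simp_all add: inverse_mult_eq_1' flip: D2_def\<close>)
  have sub: "subdegree c1 = r-1" "subdegree c2 = r-1" "c1 \<noteq> 0" "c2 \<noteq> 0"
    using D0 by (auto simp: c1_def c2_def)
  then have sub': "subdegree (c1 * fps_X) = r" "subdegree (c2 * fps_X) = r"
    using r by simp_all
  have cop: "coprime r (r-1)" "coprime (r-1) r"
    using r coprime_diff_one_right_nat[of r] by (simp_all add: coprime_commute)
  obtain P1 where P1: "prime_elem P1" "\<And>h. param (c1 * fps_X) c1 h = 0 \<longleftrightarrow> P1 dvd h" "at_u0 P1 = fps_X ^ r"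
    using kernel_param[OF sub'(1) sub(1) _ _ cop(1)] r by auto
  obtain P2 where P2: "prime_elem P2" "\<And>h. param c2 (c2 * fps_X) h = 0 \<longleftrightarrow> P2 dvd h" "at_u0 P2 = fps_X ^ (r-1)"
    using kernel_param[OF sub(2) sub'(2) _ _ cop(2)] r by auto
  have zero: "c1 $ 0 = 0" "c2 $ 0 = 0" "(c1 * fps_X) $ 0 = 0" "(c2 * fps_X) $ 0 = 0"
    using sub r by (auto intro: nth_less_subdegree_zero)
  have param_g: "param a b g = form r a b - a ^ (r-1) * b ^ (r-1)" if "a $ 0 = 0" "b $ 0 = 0" for a b
    using unital_hom_simps[OF unital_hom_param[OF that]] param_v[OF that] param_u[OF that] by (simp add: g form_def)
  have "P1 dvd g" using P1(2)[of g] param_g[OF zero(3,1)] par1 by simp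
  then obtain q where q: "g = P1 * q" by (elim dvdE)
  note hu = unital_hom_simps[OF unital_hom_at_u0]
  \<comment> \<open>The cofactor would be a unit, so both primes would have the same order on u = 0;
    the orders are r and r-1.\<close>
  have not_assoc: "\<not> P2 dvd P1"
  proof
    assume "P2 dvd P1"
    then obtain k where k: "P1 = P2 * k" by (elim dvdE)
    have "\<not> P2 dvd 1" using P2(1) by (simp add: prime_elem_def)
    then have "k dvd 1" using irreducibleD[OF prime_elem_irreducible[OF P1(1)] k] by blast
    then obtain k' where "1 = k * k'" by (elim dvdE)
    then have "at_u0 k * at_u0 k' = 1" using hu(2,4) by metis
    then have "subdegree (at_u0 k * at_u0 k') = 0" "at_u0 k \<noteq> 0" "at_u0 k' \<noteq> 0" by auto
    then have k0: "subdegree (at_u0 k) = 0" "at_u0 k \<noteq> 0" by simp_all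
    have "fps_X ^ r = fps_X ^ (r-1) * at_u0 k" using P1(3) P2(3) k hu(4) by metis
    from this[THEN arg_cong, of subdegree] show False using r k0 by (simp add: subdegree_power)
  qed
  have "P2 dvd P1 * q" using P2(2)[of g] param_g[OF zero(2,4)] par2 q by simp
  then have "P2 dvd q" using not_assoc P2(1) prime_elem_dvd_multD by blast
  then obtain w where w: "g = P1 * P2 * w" using q by (auto elim!: dvdE simp: mult.assoc)
  \<comment> \<open>On u = 0 the local equation is v^(2r-1), with coefficient 2 instead of 1 for r =
    3. The two primes already use up the order r + (r-1), so \<open>w\<close> has a nonzero constant
    term.\<close>
  have "w dvd 1"
  proof (rule unit_fps2)
    have "at_u0 u_loc = 0" "at_u0 v_loc = fps_X"
      by (rule fps_ext, simp add: at_u0_def u_loc_def v_loc_def fps_X_def)+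
    then have "at_u0 g = form r 0 fps_X" using r by (simp add: g form_def hu power_0_left)
    moreover have "form r 0 (fps_X :: complex fps) $ (2*r-1) \<noteq> 0"
      using r by (cases "r = 3") (simp_all add: form_def power_0_left fps_X_power_nth numeral_fps_const)
    moreover have "at_u0 g = fps_X ^ (2*r-1) * at_u0 w"
    proof -
      have "fps_X ^ (2*r-1) = fps_X ^ r * (fps_X ^ (r-1) :: complex fps)"
        unfolding power_add[symmetric] by (rule arg_cong) (use r in simp)
      then show ?thesis by (simp add: w hu P1(3) P2(3))
    qed
    moreover have "(fps_X ^ (2*r-1) * at_u0 w) $ (2*r-1) = at_u0 w $ 0"
      by (simp only: fps_X_power_mult_nth) simp
    ultimately have "at_u0 w $ 0 \<noteq> 0" by metis
    then show "w $ 0 $ 0 \<noteq> 0" by (simp add: at_u0_def)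
  qed
  let ?R = "{(p, q). p dvd q \<and> q dvd (p :: fps2)}"
  have class_eq: "?R `` {p} = ?R `` {P}" if "p dvd P \<and> P dvd p" for p P
    using that by (auto intro: dvd_trans)
  have dvd: "P1 dvd g" "P2 dvd g" by (simp_all add: w mult.assoc)
  have "{p. irreducible p \<and> p dvd g} // ?R = {?R `` {P1}, ?R `` {P2}}"
  proof (intro equalityI subsetI)
    fix X assume "X \<in> {p. irreducible p \<and> p dvd g} // ?R"
    then obtain p where p: "irreducible p" "p dvd g" "X = ?R `` {p}" by (auto elim: quotientE)
    show "X \<in> {?R `` {P1}, ?R `` {P2}}"
      using irreducible_divisor_of_primes[OF P1(1) P2(1) \<open>w dvd 1\<close> p(1) p(2)[unfolded w]] class_eq p(3) by blast
  next
    fix X assume "X \<in> {?R `` {P1}, ?R `` {P2}}"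
    moreover have "?R `` {P} \<in> {p. irreducible p \<and> p dvd g} // ?R" if "prime_elem P" "P dvd g" for P
      by (rule quotientI) (simp add: prime_elem_irreducible that)
    ultimately show "X \<in> {p. irreducible p \<and> p dvd g} // ?R" using P1(1) P2(1) dvd by blast
  qed
  moreover have "?R `` {P1} \<noteq> ?R `` {P2}"
  proof
    assume eq: "?R `` {P1} = ?R `` {P2}"
    have "P1 \<in> ?R `` {P1}" by simp
    then have "P1 \<in> ?R `` {P2}" unfolding eq .
    then show False using not_assoc by simp
  qed
  ultimately show ?thesis unfolding branches_def g_def[symmetric] by simp
qed

theorem proposition4p3:
  fixes d r :: nat and f :: poly3
  assumes "d = 2 * r - 1" and "d \<ge> 5"
    and "f = (Y ^ 3 - X ^ 2 * Z) * X ^ (r - 3) * Y ^ (r - 1) + X ^ d + Y ^ d"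
  shows "maximal_tjurina_curve d r f \<and>
         rational_curve f \<and>
         singular_points f = {proj_point 0 0 1} \<and>
         card (branches f 0 0 1) = 2"
proof -
  have r: "r \<ge> 3" using assms(1,2) by simp
  have "f = curve r" unfolding assms(3,1) by (rule curve_altdef[OF r])
  then show ?thesis
    using maximal_tjurina_curve_curve[OF r] rational_curve_curve[OF r] singular_points_curve[OF r]
      card_branches_curve[OF r] assms(1) by simp
qed

end
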